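(* The relative cubical singular homology groups $dH_n(-,-)$ form a digital homology theory. That is, the $dH_n(-,-)$ are functors from the category $\mathsf{Dig^2}$ of digital image pairs to the category of abelian groups which, together with natural transformations $\partial_*:dH_n(X,A)\to dH_{n-1}(A)$ (where $dH_{n-1}(A)$ denotes $dH_{n-1}(A,\emptyset)$), satisfy the following axioms. Homotopy: if $f,g:((X,A),\kappa)\to((Y,B),\lambda)$ are $(\kappa,\lambda)$-homotopic as maps of pairs, then $f_*,g_*:dH_n(X,A)\to dH_n(Y,B)$ are equal. Exactness: for each digital image pair $(X,A)$ with inclusions $i:A\hookrightarrow X$ and $j:(X,\emptyset)\hookrightarrow(X,A)$, there is a long exact sequence $$\cdots\xrightarrow{\partial_*}dH_n(A)\xrightarrow{i_*}dH_n(X)\xrightarrow{j_*}dH_n(X,A)\xrightarrow{\partial_*}dH_{n-1}(A)\xrightarrow{i_*}\cdots.$$ Excision: for a digital image pair $(X,A)$ with adjacency $\kappa$ and a subset $W\subset A$ such that there is a positive integer $i$ with $Cl_\kappa^i(W)\subset Int_\kappa^i(A)$, the inclusion $(X-W,A-W)\to(X,A)$ induces isomorphisms $dH_n(X-W,A-W)\to dH_n(X,A)$ for $0\le n\le i+1$. Dimension: if $X=\{x_0\}$ is a one-point digital image, then $dH_n(X)=0$ for all $n>0$. Additivity: if $\{(X_\alpha,\kappa):\alpha\in\Lambda\}$ is a collection of mutually $\kappa$-disconnected digital images with $X_\alpha\subset\mathbb{Z}^d$, and $(X,\kappa)$ is the digital image $X=\bigcup_\alpha X_\alpha$, then $dH_n(X)\cong\bigoplus_\alpha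 dH_n(X_\alpha)$.
   Context: A digital image $(X,\kappa)$ is a finite subset $X\subset\mathbb{Z}^d$ ($d\ge 1$) equipped with an adjacency relation $\kappa=c_l$ for some $1\le l\le d$, where distinct points $p,q\in\mathbb{Z}^d$ are $c_l$-adjacent if at most $l$ of their coordinates differ by one unit and all remaining coordinates are equal. For integers $a<b$, $[a,b]_{\mathbb{Z}}=\{a,\dots,b\}$ with the adjacency $c_1$ of $\mathbb{Z}$ (denoted $2$). A function $f:(X,\kappa)\to(Y,\lambda)$ is $(\kappa,\lambda)$-continuous if whenever $x_0,x_1$ are $\kappa$-adjacent, $f(x_0),f(x_1)$ are equal or $\lambda$-adjacent. Digital images $(X,\kappa),(Y,\kappa)$ with $X,Y\subset\mathbb{Z}^d$ are $\kappa$-disconnected with each other if no $x\in X$ is $\kappa$-adjacent in $\mathbb{Z}^d$ to any $y\in Y$. Pairs. A digital image pair $((X,A),\kappa)$ consists of a digital image $(X,\kappa)$ and $A\subset X$ (with the same adjacency). A $(\kappa,\lambda)$-continuous map of pairs $f:(X,A)\to(Y,B)$ is a $(\kappa,\lambda)$-continuous $f:X\to Y$ with $f(A)\subset B$. $\mathsf{Dig^2}$ is the category of digital image pairs and continuous maps of pairs. Maps of pairs $f,g:(X,A)\to(Y,B)$ are $(\kappa,\lambda)$-homotopic as maps of pairs if there are a positive integer $m$ and $H:[0,m]_{\mathbb{Z}}\times X\to Y$ with $H(0,x)=f(x)$, $H(m,x)=g(x)$ for all $x$, each $H(\cdot,x)$ being $(2,\lambda)$-continuous, each $H(t,\cdot)$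 being $(\kappa,\lambda)$-continuous, and $H(t,A)\subset B$ for all $t$. $\kappa$-interior and $\kappa$-closure in $X$. $N_\kappa(x,X)=\{y\in X:y=x\text{ or }y\text{ is }\kappa\text{-adjacent to }x\}$; $Int_\kappa(A)=\{x\in A:N_\kappa(x,X)\subset A\}$; $Cl_\kappa(A)=\{x\in X:N_\kappa(x,X)\cap A\neq\emptyset\}$; $Int^0_\kappa(A)=Cl^0_\kappa(A)=A$, and $Int^i_\kappa(A)=Int_\kappa(Int^{i-1}_\kappa(A))$, $Cl^i_\kappa(A)=Cl_\kappa(Cl^{i-1}_\kappa(A))$ for $i\ge1$. Cubical singular homology. $I=[0,1]_{\mathbb{Z}}$, and $I^n$ carries the $c_1$-adjacency of $\mathbb{Z}^n$ (denoted $2n$); $I^0$ is a point. A digital $n$-cube in $(X,\kappa)$ is a $(2n,\kappa)$-continuous map $T:I^n\to X$; it is degenerate if for some $i$, $T(t_1,\dots,t_n)$ does not depend on $t_i$. $dQ_n(X)$ is the free abelian group on digital $n$-cubes, $dD_n(X)$ the subgroup generated by degenerate ones, $dC_n(X)=dQ_n(X)/dD_n(X)$ (zero for $n<0$). Put $A_iT(t_1,\dots,t_{n-1})=T(t_1,\dots,t_{i-1},0,t_i,\dots,t_{n-1})$, $B_iT(t_1,\dots,t_{n-1})=T(t_1,\dots,t_{i-1},1,t_i,\dots,t_{n-1})$, $\partial_nT=\sum_{i=1}^n(-1)^i(A_iT-B_iT)$ (with $\partial_n=0$ for $n\le0$); this induces a boundary map on $dC_\bullet(X)$ with $\partial\partial=0$.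 For $A\subset X$, $dC_n(A)\subset dC_n(X)$ is preserved by $\partial$; $dC_n(X,A)=dC_n(X)/dC_n(A)$ with the induced boundary, and $dH_n(X,A)$ is the $n$-th homology group of $(dC_\bullet(X,A),\partial)$; $dH_n(X)=dH_n(X,\emptyset)$. A map of pairs $f$ induces $f_*$ via $T\mapsto f\circ T$.
   Formalization: Excision for i = 1, n = 2 claims only surjectivity, as injectivity fails for X={0,1}^3 with c_1, A=X−{(1,1,1)}, W={(0,0,0)}; in Additivity the X_α are also required pairwise disjoint, since κ-disconnected images may share isolated points, making n = 0 false. *)

theory Defs
  imports "HOL-Algebra.Free_Abelian_Groups" "HOL-Algebra.Exact_Sequence"
begin

section \<open>Digital images\<close>

text \<open>A point of \<open>\<int>\<^sup>d\<close> is an integer list of length \<open>d\<close>; thus one type serves all dimensions.\<close>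

type_synonym point = "int list"

definition c_adj :: "nat \<Rightarrow> point \<Rightarrow> point \<Rightarrow> bool" where
  "c_adj l p q \<longleftrightarrow> length p = length q \<and> p \<noteq> q
     \<and> (\<forall>i<length p. p ! i = q ! i \<or> \<bar>p ! i - q ! i\<bar> = 1)
     \<and> card {i. i < length p \<and> p ! i \<noteq> q ! i} \<le> l"

definition digital_image :: "nat \<Rightarrow> nat \<Rightarrow> point set \<Rightarrow> bool" where
  "digital_image d l X \<longleftrightarrow> 1 \<le> l \<and> l \<le> d \<and> finite X \<and> (\<forall>p\<in>X. length p = d)"

definition digital_pair :: "nat \<Rightarrow> nat \<Rightarrow> point set \<Rightarrow> point set \<Rightarrow> bool" where
  "digital_pair d l X A \<longleftrightarrow> digital_image d l X \<and> A \<subseteq> X"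

text \<open>The remaining notions only use the adjacency relation \<open>\<kappa>\<close>; they are applied to \<open>\<kappa> = c_adj l\<close>.\<close>

definition dig_continuous ::
    "('a \<Rightarrow> 'a \<Rightarrow> bool) \<Rightarrow> 'a set \<Rightarrow> ('b \<Rightarrow> 'b \<Rightarrow> bool) \<Rightarrow> 'b set \<Rightarrow> ('a \<Rightarrow> 'b) \<Rightarrow> bool" where
  "dig_continuous \<kappa> X \<nu> Y f \<longleftrightarrow> f \<in> X \<rightarrow> Y
     \<and> (\<forall>x\<in>X. \<forall>x'\<in>X. \<kappa> x x' \<longrightarrow> f x = f x' \<or> \<nu> (f x) (f x'))"

definition pair_map ::
    "('a \<Rightarrow> 'a \<Rightarrow> bool) \<Rightarrow> 'a set \<Rightarrow> 'a set \<Rightarrow> ('b \<Rightarrow> 'b \<Rightarrow> bool) \<Rightarrow> 'b set \<Rightarrow> 'b set \<Rightarrow> ('a \<Rightarrow> 'b) \<Rightarrow> bool"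
  where "pair_map \<kappa> X A \<nu> Y B f \<longleftrightarrow> dig_continuous \<kappa> X \<nu> Y f \<and> f ` A \<subseteq> B"

text \<open>The adjacency \<open>c\<^sub>1\<close> of \<open>\<int>\<close>, on integers instead of one-element lists.\<close>

definition int_adj :: "int \<Rightarrow> int \<Rightarrow> bool" where
  "int_adj s t \<longleftrightarrow> c_adj 1 [s] [t]"

definition pair_homotopic ::
    "('a \<Rightarrow> 'a \<Rightarrow> bool) \<Rightarrow> 'a set \<Rightarrow> 'a set \<Rightarrow> ('b \<Rightarrow> 'b \<Rightarrow> bool) \<Rightarrow> 'b set \<Rightarrow> 'b set
      \<Rightarrow> ('a \<Rightarrow> 'b) \<Rightarrow> ('a \<Rightarrow> 'b) \<Rightarrow> bool" where
  "pair_homotopic \<kappa> X A \<nu> Y B f g \<longleftrightarrow>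
     (\<exists>m>0. \<exists>H :: int \<Rightarrow> 'a \<Rightarrow> 'b.
        (\<forall>x\<in>X. H 0 x = f x \<and> H m x = g x)
      \<and> (\<forall>x\<in>X. dig_continuous int_adj {0..m} \<nu> Y (\<lambda>t. H t x))
      \<and> (\<forall>t\<in>{0..m}. dig_continuous \<kappa> X \<nu> Y (H t))
      \<and> (\<forall>t\<in>{0..m}. H t ` A \<subseteq> B))"

definition dig_disconnected :: "('a \<Rightarrow> 'a \<Rightarrow> bool) \<Rightarrow> 'a set \<Rightarrow> 'a set \<Rightarrow> bool" where
  "dig_disconnected \<kappa> X Y \<longleftrightarrow> (\<forall>x\<in>X. \<forall>y\<in>Y. \<not> \<kappa> x y)"

definition dig_nbhd :: "('a \<Rightarrow> 'a \<Rightarrow> bool) \<Rightarrow> 'a set \<Rightarrow> 'a \<Rightarrow> 'a set" where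
  "dig_nbhd \<kappa> X x = {y \<in> X. y = x \<or> \<kappa> y x}"

definition dig_Int :: "('a \<Rightarrow> 'a \<Rightarrow> bool) \<Rightarrow> 'a set \<Rightarrow> 'a set \<Rightarrow> 'a set" where
  "dig_Int \<kappa> X A = {x \<in> A. dig_nbhd \<kappa> X x \<subseteq> A}"

definition dig_Cl :: "('a \<Rightarrow> 'a \<Rightarrow> bool) \<Rightarrow> 'a set \<Rightarrow> 'a set \<Rightarrow> 'a set" where
  "dig_Cl \<kappa> X A = {x \<in> X. dig_nbhd \<kappa> X x \<inter> A \<noteq> {}}"


section \<open>Maps induced on quotient groups\<close>

text \<open>For \<open>f : G \<rightarrow> H\<close> sending \<open>N\<close> into \<open>M\<close>, the induced map \<open>G Mod N \<rightarrow> H Mod M\<close> sends the coset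
  \<open>N #> x\<close> to \<open>M #> f x\<close>. Here the latter is obtained as the union of the cosets \<open>M #> f x'\<close>, which
  all coincide, over the elements \<open>x'\<close> of the given coset.\<close>

definition quot_map :: "('h, 'm) monoid_scheme \<Rightarrow> 'h set \<Rightarrow> ('g \<Rightarrow> 'h) \<Rightarrow> 'g set \<Rightarrow> 'h set" where
  "quot_map H M f K = M <#>\<^bsub>H\<^esub> (f ` K)"


section \<open>Digital cubes\<close>

type_synonym 'a cube = "int list \<Rightarrow> 'a"

type_synonym 'a cube_chain = "'a cube \<Rightarrow>\<^sub>0 int"

definition unit_cube :: "nat \<Rightarrow> int list set" where
  "unit_cube n = {t. length t = n \<and> set t \<subseteq> {0, 1}}"

definition digital_cube :: "nat \<Rightarrow> ('a \<Rightarrow> 'a \<Rightarrow> bool) \<Rightarrow> 'a set \<Rightarrow> 'a cube \<Rightarrow> bool" where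
  "digital_cube n \<kappa> X T \<longleftrightarrow>
     dig_continuous (c_adj 1) (unit_cube n) \<kappa> X T \<and> T \<in> extensional (unit_cube n)"

definition degenerate_cube :: "nat \<Rightarrow> 'a cube \<Rightarrow> bool" where
  "degenerate_cube n T \<longleftrightarrow> (\<exists>i<n. \<forall>t\<in>unit_cube n. \<forall>s\<in>{0, 1}. T (t[i := s]) = T t)"

text \<open>For \<open>1 \<le> i \<le> n\<close>, \<open>cube_face n i 0\<close> is \<open>A\<^sub>i\<close> and \<open>cube_face n i 1\<close> is \<open>B\<^sub>i\<close>.\<close>

definition cube_face :: "nat \<Rightarrow> nat \<Rightarrow> int \<Rightarrow> 'a cube \<Rightarrow> 'a cube" where
  "cube_face n i s T =
     restrict (\<lambda>t. T (take (i - 1) t @ s # drop (i - 1) t)) (unit_cube (n - 1))"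

definition cube_boundary :: "nat \<Rightarrow> 'a cube \<Rightarrow> 'a cube_chain" where
  "cube_boundary n T =
     (\<Sum>i=1..n. frag_cmul ((-1) ^ i) (frag_of (cube_face n i 0 T) - frag_of (cube_face n i 1 T)))"


section \<open>The cubical singular chain complex\<close>

text \<open>Degrees are integers; all groups below are trivial in negative degrees, as there are then no
  generators, and the boundary is zero in degrees \<open>\<le> 0\<close>, as \<open>cube_boundary 0\<close> is an empty sum.\<close>

definition dQ :: "int \<Rightarrow> ('a \<Rightarrow> 'a \<Rightarrow> bool) \<Rightarrow> 'a set \<Rightarrow> 'a cube_chain monoid" where
  "dQ n \<kappa> X = free_Abelian_group {T. 0 \<le> n \<and> digital_cube (nat n) \<kappa> X T}"

definition dD :: "int \<Rightarrow> ('a \<Rightarrow> 'a \<Rightarrow> bool) \<Rightarrow> 'a set \<Rightarrow> 'a cube_chain set" where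
  "dD n \<kappa> X = generate (dQ n \<kappa> X)
     (frag_of ` {T. 0 \<le> n \<and> digital_cube (nat n) \<kappa> X T \<and> degenerate_cube (nat n) T})"

definition dQ_boundary :: "int \<Rightarrow> 'a cube_chain \<Rightarrow> 'a cube_chain" where
  "dQ_boundary n = frag_extend (cube_boundary (nat n))"

definition dC :: "int \<Rightarrow> ('a \<Rightarrow> 'a \<Rightarrow> bool) \<Rightarrow> 'a set \<Rightarrow> 'a cube_chain set monoid" where
  "dC n \<kappa> X = dQ n \<kappa> X Mod dD n \<kappa> X"

definition dC_boundary ::
    "int \<Rightarrow> ('a \<Rightarrow> 'a \<Rightarrow> bool) \<Rightarrow> 'a set \<Rightarrow> 'a cube_chain set \<Rightarrow> 'a cube_chain set" where
  "dC_boundary n \<kappa> X = quot_map (dQ (n - 1) \<kappa> X) (dD (n - 1) \<kappa> X) (dQ_boundary n)"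

text \<open>For \<open>A \<subseteq> X\<close>, the map \<open>dC n \<kappa> A \<rightarrow> dC n \<kappa> X\<close> induced by the inclusion, through which
  \<open>dC n \<kappa> A\<close> is regarded as the subgroup \<open>dC_sub n \<kappa> X A\<close> of \<open>dC n \<kappa> X\<close>.\<close>

definition dC_incl ::
    "int \<Rightarrow> ('a \<Rightarrow> 'a \<Rightarrow> bool) \<Rightarrow> 'a set \<Rightarrow> 'a cube_chain set \<Rightarrow> 'a cube_chain set" where
  "dC_incl n \<kappa> X = quot_map (dQ n \<kappa> X) (dD n \<kappa> X) (\<lambda>c. c)"

definition dC_sub :: "int \<Rightarrow> ('a \<Rightarrow> 'a \<Rightarrow> bool) \<Rightarrow> 'a set \<Rightarrow> 'a set \<Rightarrow> 'a cube_chain set set" where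
  "dC_sub n \<kappa> X A = dC_incl n \<kappa> X ` carrier (dC n \<kappa> A)"

definition dC_rel ::
    "int \<Rightarrow> ('a \<Rightarrow> 'a \<Rightarrow> bool) \<Rightarrow> 'a set \<Rightarrow> 'a set \<Rightarrow> 'a cube_chain set set monoid" where
  "dC_rel n \<kappa> X A = dC n \<kappa> X Mod dC_sub n \<kappa> X A"

definition dC_rel_boundary ::
    "int \<Rightarrow> ('a \<Rightarrow> 'a \<Rightarrow> bool) \<Rightarrow> 'a set \<Rightarrow> 'a set \<Rightarrow> 'a cube_chain set set \<Rightarrow> 'a cube_chain set set" where
  "dC_rel_boundary n \<kappa> X A =
     quot_map (dC (n - 1) \<kappa> X) (dC_sub (n - 1) \<kappa> X A) (dC_boundary n \<kappa> X)"


section \<open>Relative homology\<close>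

definition dZ :: "int \<Rightarrow> ('a \<Rightarrow> 'a \<Rightarrow> bool) \<Rightarrow> 'a set \<Rightarrow> 'a set \<Rightarrow> 'a cube_chain set set monoid" where
  "dZ n \<kappa> X A = (dC_rel n \<kappa> X A)
     \<lparr>carrier := kernel (dC_rel n \<kappa> X A) (dC_rel (n - 1) \<kappa> X A) (dC_rel_boundary n \<kappa> X A)\<rparr>"

definition dB :: "int \<Rightarrow> ('a \<Rightarrow> 'a \<Rightarrow> bool) \<Rightarrow> 'a set \<Rightarrow> 'a set \<Rightarrow> 'a cube_chain set set set" where
  "dB n \<kappa> X A = dC_rel_boundary (n + 1) \<kappa> X A ` carrier (dC_rel (n + 1) \<kappa> X A)"

definition dH :: "int \<Rightarrow> ('a \<Rightarrow> 'a \<Rightarrow> bool) \<Rightarrow> 'a set \<Rightarrow> 'a set \<Rightarrow> 'a cube_chain set set set monoid" where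
  "dH n \<kappa> X A = dZ n \<kappa> X A Mod dB n \<kappa> X A"

text \<open>The maps induced by \<open>f : (X, A) \<rightarrow> (Y, B)\<close>. Only \<open>(Y, B)\<close> occurs as a parameter because
  \<^const>\<open>quot_map\<close> depends on its source only through the coset to which it is applied.\<close>

definition dQ_map :: "int \<Rightarrow> ('a \<Rightarrow> 'b) \<Rightarrow> 'a cube_chain \<Rightarrow> 'b cube_chain" where
  "dQ_map n f = frag_extend (\<lambda>T. frag_of (restrict (f \<circ> T) (unit_cube (nat n))))"

definition dC_map ::
    "int \<Rightarrow> ('b \<Rightarrow> 'b \<Rightarrow> bool) \<Rightarrow> 'b set \<Rightarrow> ('a \<Rightarrow> 'b) \<Rightarrow> 'a cube_chain set \<Rightarrow> 'b cube_chain set" where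
  "dC_map n \<nu> Y f = quot_map (dQ n \<nu> Y) (dD n \<nu> Y) (dQ_map n f)"

definition dC_rel_map ::
    "int \<Rightarrow> ('b \<Rightarrow> 'b \<Rightarrow> bool) \<Rightarrow> 'b set \<Rightarrow> 'b set \<Rightarrow> ('a \<Rightarrow> 'b)
      \<Rightarrow> 'a cube_chain set set \<Rightarrow> 'b cube_chain set set" where
  "dC_rel_map n \<nu> Y B f = quot_map (dC n \<nu> Y) (dC_sub n \<nu> Y B) (dC_map n \<nu> Y f)"

definition dH_map ::
    "int \<Rightarrow> ('b \<Rightarrow> 'b \<Rightarrow> bool) \<Rightarrow> 'b set \<Rightarrow> 'b set \<Rightarrow> ('a \<Rightarrow> 'b)
      \<Rightarrow> 'a cube_chain set set set \<Rightarrow> 'b cube_chain set set set" where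
  "dH_map n \<nu> Y B f = quot_map (dZ n \<nu> Y B) (dB n \<nu> Y B) (dC_rel_map n \<nu> Y B f)"

text \<open>The homology class of a chain in \<open>dC n \<kappa> X\<close> whose boundary lies in \<open>dC (n - 1) \<kappa> A\<close>.\<close>

definition dH_class ::
    "int \<Rightarrow> ('a \<Rightarrow> 'a \<Rightarrow> bool) \<Rightarrow> 'a set \<Rightarrow> 'a set \<Rightarrow> 'a cube_chain set \<Rightarrow> 'a cube_chain set set set" where
  "dH_class n \<kappa> X A u = dB n \<kappa> X A #>\<^bsub>dZ n \<kappa> X A\<^esub> (dC_sub n \<kappa> X A #>\<^bsub>dC n \<kappa> X\<^esub> u)"

text \<open>The connecting homomorphism of the short exact sequence
  \<open>0 \<rightarrow> dC A \<rightarrow> dC X \<rightarrow> dC (X, A) \<rightarrow> 0\<close>: the class of \<open>u\<close> goes to the class of the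
  chain \<open>v\<close> of \<open>A\<close> that equals the boundary of \<open>u\<close>.\<close>

definition dH_connecting ::
    "int \<Rightarrow> ('a \<Rightarrow> 'a \<Rightarrow> bool) \<Rightarrow> 'a set \<Rightarrow> 'a set
      \<Rightarrow> 'a cube_chain set set set \<Rightarrow> 'a cube_chain set set set" where
  "dH_connecting n \<kappa> X A h =
     (THE k. \<exists>u\<in>carrier (dC n \<kappa> X). \<exists>v\<in>carrier (dC (n - 1) \<kappa> A).
        h = dH_class n \<kappa> X A u \<and> dC_incl (n - 1) \<kappa> X v = dC_boundary n \<kappa> X u
        \<and> k = dH_class (n - 1) \<kappa> A {} v)"

end

theory Submission
  imports Defs
begin

text \<open>The iterated quotient \<^const>\<open>dH\<close> is presented by honest chains: its classes are
  represented by the chains \<open>c\<close> of cubes of \<open>X\<close> such that every cube of \<open>\<partial>c\<close> lies in \<open>A\<close> or is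
  degenerate, and \<open>c\<close> represents zero iff \<open>c - \<partial>b\<close> is again such a combination for some \<open>b\<close>.
  As all subgroups of chains involved are cut out by a condition on the support, intersections and
  decompositions of them can be computed cube by cube. Exactness and naturality become short
  computations with chains, and homotopy invariance comes from the prism operator of a one-step
  homotopy. For excision, an \<open>n\<close>-cube meeting \<open>W\<close> stays within distance \<open>n\<close> of \<open>W\<close>, while the
  hypothesis puts the ball of radius \<open>2i\<close> about \<open>W\<close> inside \<open>A\<close>; hence for \<open>n \<le> 2i\<close> every \<open>n\<close>-cube
  lies in \<open>A\<close> or avoids \<open>W\<close>. For additivity, a cube cannot leave the component in which one of its
  vertices lies.\<close>

section \<open>Presentations of abelian groups by additive subgroups\<close>

text \<open>The group \<open>dH\<close> consists of cosets of cosets of cosets, and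
  \<open>quot_map\<close> is a union over all elements of a coset, so an induced map can be
  evaluated only after the dependence on representatives has been resolved. A
  \<open>presentation\<close> records at each stage which chains represent an element and which
  represent zero: a quotient enlarges only the second set, a restriction to a subgroup shrinks only
  the first. The connecting map is a definite description over all lifts, so its value requires
  independence of the lift. This rests on the fact that a chain of A that is degenerate in X is
  already degenerate in A. The classical proof of excision subdivides cubes until they are small;
  here a cube is small only because of its dimension. Surjectivity in degree n splits the n-cubes,
  injectivity the (n+1)-cubes. Splitting works up to dimension 2i, so n \<le> i + 1 gives
  surjectivity for every i \<ge> 1, and injectivity unless i = 1 and n = 2.\<close>

definition add_closed :: "'c::ab_group_add set \<Rightarrow> bool" where
  "add_closed S \<longleftrightarrow> 0 \<in> S \<and> (\<forall>x\<in>S. \<forall>y\<in>S. x - y \<in> S)"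

lemma add_closedD:
  assumes "add_closed S"
  shows add_closed_zero: "0 \<in> S"
    and add_closed_diff: "x \<in> S \<Longrightarrow> y \<in> S \<Longrightarrow> x - y \<in> S"
    and add_closed_minus: "x \<in> S \<Longrightarrow> - x \<in> S"
    and add_closed_add: "x \<in> S \<Longrightarrow> y \<in> S \<Longrightarrow> x + y \<in> S"
proof -
  show 0: "0 \<in> S" and d: "x \<in> S \<Longrightarrow> y \<in> S \<Longrightarrow> x - y \<in> S" for x y
    using assms by (auto simp: add_closed_def)
  show m: "x \<in> S \<Longrightarrow> - x \<in> S" for x using d[OF 0, of x] by simp
  show "x \<in> S \<Longrightarrow> y \<in> S \<Longrightarrow> x + y \<in> S" using d[OF _ m, of x y] by simp
qed

text \<open>The kernel on representatives is Z \<inter> K. As K may reach beyond Z,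
  \<open>restrict_carrier\<close> can shrink Z and keep the same K.\<close>

locale presentation = comm_group G for G (structure) +
  fixes Z K :: "'c::ab_group_add set" and \<phi> :: "'c \<Rightarrow> 'a"
  assumes Z: "add_closed Z"
    and image_Z: "\<phi> ` Z = carrier G"
    and add: "x \<in> Z \<Longrightarrow> y \<in> Z \<Longrightarrow> \<phi> (x + y) = \<phi> x \<otimes> \<phi> y"
    and one_iff: "x \<in> Z \<Longrightarrow> \<phi> x = \<one> \<longleftrightarrow> x \<in> K"
begin

lemma closed: "x \<in> Z \<Longrightarrow> \<phi> x \<in> carrier G"
  using image_Z by blast

lemma zero: "\<phi> 0 = \<one>"
proof -
  have "\<phi> 0 \<otimes> \<phi> 0 = \<phi> 0" using add[of 0 0] add_closed_zero[OF Z] by simp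
  then show ?thesis using closed[OF add_closed_zero[OF Z]] by simp
qed

lemma minus: "x \<in> Z \<Longrightarrow> \<phi> (- x) = inv \<phi> x"
  using add[of "- x" x] zero closed add_closed_minus[OF Z]
  by (metis add.left_inverse inv_equality)

lemma diff: "x \<in> Z \<Longrightarrow> y \<in> Z \<Longrightarrow> \<phi> (x - y) = \<phi> x \<otimes> inv \<phi> y"
  using add[of x "- y"] minus add_closed_minus[OF Z] by simp

lemma eq_iff: "x \<in> Z \<Longrightarrow> y \<in> Z \<Longrightarrow> \<phi> x = \<phi> y \<longleftrightarrow> x - y \<in> K"
  using one_iff[OF add_closed_diff[OF Z], of x y] diff[of x y] closed[of x] closed[of y]
  by (metis inv_closed inv_equality inv_inv r_inv)

lemma subgroup_image:
  assumes "add_closed L" "L \<subseteq> Z"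
  shows "subgroup (\<phi> ` L) G"
proof (rule subgroupI)
  show "\<phi> ` L \<subseteq> carrier G" using assms closed by blast
  show "\<phi> ` L \<noteq> {}" using assms add_closed_zero by blast
  show "inv a \<in> \<phi> ` L" if a: "a \<in> \<phi> ` L" for a
  proof -
    obtain x where x: "x \<in> L" "a = \<phi> x" using a by blast
    with assms have "- x \<in> L" "x \<in> Z" by (auto intro: add_closed_minus)
    then show ?thesis using x minus[of x] by (metis imageI)
  qed
  show "a \<otimes> b \<in> \<phi> ` L" if ab: "a \<in> \<phi> ` L" "b \<in> \<phi> ` L" for a b
  proof -
    obtain x y where xy: "x \<in> L" "y \<in> L" "a = \<phi> x" "b = \<phi> y" using ab by blast
    with assms have "x + y \<in> L" "x \<in> Z" "y \<in> Z" by (auto intro: add_closed_add)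
    then show ?thesis using xy add[of x y] by (metis imageI)
  qed
qed

text \<open>A coset of the image of L is trivial iff its representative agrees modulo K with some
  element of L. The new null set is therefore L + K, while the representatives stay the
  same.\<close>

lemma quotient:
  assumes L: "add_closed L" "L \<subseteq> Z"
    and K': "\<And>x. x \<in> Z \<Longrightarrow> x \<in> K' \<longleftrightarrow> (\<exists>l\<in>L. x - l \<in> K)"
  shows "presentation (G Mod \<phi> ` L) Z K' (\<lambda>x. \<phi> ` L #> \<phi> x)"
proof -
  note sub = subgroup_image[OF L]
  interpret N: normal "\<phi> ` L" G using sub by (rule subgroup_imp_normal)
  interpret Q: comm_group "G Mod \<phi> ` L" using sub by (rule abelian_FactGroup)
  show ?thesis
  proof
    show "(\<lambda>x. \<phi> ` L #> \<phi> x) ` Z = carrier (G Mod \<phi> ` L)"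
      by (simp add: carrier_FactGroup flip: image_Z) (simp add: image_image)
    show "\<phi> ` L #> \<phi> (x + y) = (\<phi> ` L #> \<phi> x) \<otimes>\<^bsub>G Mod \<phi> ` L\<^esub> (\<phi> ` L #> \<phi> y)"
      if "x \<in> Z" "y \<in> Z" for x y
      using that by (simp add: N.rcos_sum closed add)
    show "\<phi> ` L #> \<phi> x = \<one>\<^bsub>G Mod \<phi> ` L\<^esub> \<longleftrightarrow> x \<in> K'" if "x \<in> Z" for x
    proof -
      have "\<phi> ` L #> \<phi> x = \<phi> ` L \<longleftrightarrow> \<phi> x \<in> \<phi> ` L"
        using sub closed[OF that] by (metis coset_join2 rcos_self)
      also have "\<dots> \<longleftrightarrow> (\<exists>l\<in>L. x - l \<in> K)"
        unfolding image_iff by (intro bex_cong) (use eq_iff[OF that] L(2) in auto)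
      finally show ?thesis using K'[OF that] by simp
    qed
  qed (rule Z)
qed

lemma restrict_carrier:
  assumes "add_closed Z'" "Z' \<subseteq> Z" "C = \<phi> ` Z'"
  shows "presentation (G\<lparr>carrier := C\<rparr>) Z' K \<phi>"
proof -
  note sub = subgroup_image[OF assms(1,2)]
  interpret S: group "G\<lparr>carrier := C\<rparr>"
    unfolding assms(3) by (rule subgroup_imp_group[OF sub])
  interpret S: comm_group "G\<lparr>carrier := C\<rparr>"
    by (rule S.group_comm_groupI) (use subgroup.subset[OF sub] assms(3) in \<open>auto intro!: m_comm\<close>)
  show ?thesis
    by unfold_locales (use assms add one_iff in \<open>auto simp: subset_iff\<close>)
qed

text \<open>The union over all representatives collapses to one coset because L' absorbs the image
  of L under f. Additivity is asked only for a summand from L, the amount by which two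
  representatives differ.\<close>

lemma quot_map_coset:
  assumes H: "presentation H Z' K' \<phi>'"
    and L: "add_closed L" "L \<subseteq> Z" and L': "add_closed L'" "L' \<subseteq> Z'"
    and f: "f ` Z \<subseteq> Z'" "f ` L \<subseteq> L'" "\<And>x y. x \<in> L \<Longrightarrow> y \<in> Z \<Longrightarrow> f (x + y) = f x + f y"
    and \<psi>: "\<And>x. x \<in> Z \<Longrightarrow> \<psi> (\<phi> x) = \<phi>' (f x)"
    and x: "x \<in> Z"
  shows "quot_map H (\<phi>' ` L') \<psi> (\<phi> ` L #> \<phi> x) = \<phi>' ` L' #>\<^bsub>H\<^esub> \<phi>' (f x)"
proof -
  interpret H: presentation H Z' K' \<phi>' by (rule H)
  have coset: "\<phi> ` L #> \<phi> x = (\<lambda>l. \<phi> (l + x)) ` L"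
    unfolding r_coset_def using L(2) x by (auto simp: add subset_iff intro!: rev_image_eqI)
  have \<psi>_coset: "\<psi> ` (\<phi> ` L #> \<phi> x) = (\<lambda>l. \<phi>' (f l + f x)) ` L"
    unfolding coset image_image
    using L(2) x \<psi> f(3) add_closed_add[OF Z] by (intro image_cong) (auto simp: subset_iff)
  have fx: "f x \<in> Z'" using f x by blast
  have "\<phi>' k \<otimes>\<^bsub>H\<^esub> \<phi>' (f l + f x) = \<phi>' (k + (f l + f x))" if "k \<in> L'" "l \<in> L" for k l
  proof (rule H.add[symmetric])
    show "k \<in> Z'" using that L'(2) by blast
    have "f l \<in> Z'" using that f(2) L'(2) by blast
    then show "f l + f x \<in> Z'" using fx add_closed_add[OF H.Z] by blast
  qed
  then have "\<phi>' ` L' <#>\<^bsub>H\<^esub> \<psi> ` (\<phi> ` L #> \<phi> x) = (\<lambda>(k, l). \<phi>' (k + (f l + f x))) ` (L' \<times> L)"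
    unfolding \<psi>_coset set_mult_def by (fastforce intro: rev_image_eqI)
  also have "\<dots> = (\<lambda>k. \<phi>' (k + f x)) ` L'"
  proof (intro equalityI subsetI)
    fix y assume "y \<in> (\<lambda>(k, l). \<phi>' (k + (f l + f x))) ` (L' \<times> L)"
    then obtain k l where "k \<in> L'" "l \<in> L" "y = \<phi>' ((k + f l) + f x)" by (auto simp: add.assoc)
    then show "y \<in> (\<lambda>k. \<phi>' (k + f x)) ` L'"
      using f(2) add_closed_add[OF L'(1)] by blast
  next
    fix y assume "y \<in> (\<lambda>k. \<phi>' (k + f x)) ` L'"
    then obtain k where k: "k \<in> L'" "y = \<phi>' (k + f x)" by auto
    \<comment> \<open>The representative with l = 0 contributes f 0, for which the element k - f 0
      of L' compensates.\<close>
    have "f 0 \<in> L'" "0 \<in> L" using f(2) add_closed_zero[OF L(1)] by auto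
    then have "k - f 0 \<in> L'" "y = \<phi>' ((k - f 0) + (f 0 + f x))"
      using k add_closed_diff[OF L'(1)] by (auto simp: algebra_simps)
    then show "y \<in> (\<lambda>(k, l). \<phi>' (k + (f l + f x))) ` (L' \<times> L)"
      using \<open>0 \<in> L\<close> by (intro image_eqI[of _ _ "(k - f 0, 0)"]) simp_all
  qed
  also have "\<dots> = \<phi>' ` L' #>\<^bsub>H\<^esub> \<phi>' (f x)"
    unfolding r_coset_def using L'(2) fx by (auto simp: H.add subset_iff intro!: rev_image_eqI)
  finally show ?thesis by (simp add: quot_map_def)
qed

lemma hom_into:
  assumes "presentation H Z' K' \<phi>'"
    and "f ` Z \<subseteq> Z'" "\<And>x y. x \<in> Z \<Longrightarrow> y \<in> Z \<Longrightarrow> f (x + y) = f x + f y"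
    and "\<And>x. x \<in> Z \<Longrightarrow> \<psi> (\<phi> x) = \<phi>' (f x)"
  shows "\<psi> \<in> hom G H"
proof (rule homI)
  interpret H: presentation H Z' K' \<phi>' by (rule assms)
  show "\<psi> u \<in> carrier H" if "u \<in> carrier G" for u
  proof -
    obtain x where "x \<in> Z" "u = \<phi> x" using \<open>u \<in> carrier G\<close> image_Z by blast
    then show ?thesis using assms(2,4) H.closed by auto
  qed
  show "\<psi> (u \<otimes> v) = \<psi> u \<otimes>\<^bsub>H\<^esub> \<psi> v" if uv: "u \<in> carrier G" "v \<in> carrier G" for u v
  proof -
    obtain x y where "x \<in> Z" "u = \<phi> x" "y \<in> Z" "v = \<phi> y" using uv image_Z by blast
    then show ?thesis
      using assms(2-4) H.add[of "f x" "f y"] add_closed_add[OF Z, of x y]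
      by (auto simp flip: add)
  qed
qed

text \<open>Any representative picked by SOME gives the same value, as both groups have the same
  null set. In the additivity axiom this replaces writing down a map between the quotient
  groups.\<close>

lemma isomorphic:
  assumes H: "presentation H Z K \<phi>'"
  shows "G \<cong> H"
proof -
  interpret H: presentation H Z K \<phi>' by (rule H)
  define \<psi> where "\<psi> u = \<phi>' (SOME x. x \<in> Z \<and> \<phi> x = u)" for u
  have \<psi>: "\<psi> (\<phi> x) = \<phi>' x" if "x \<in> Z" for x
  proof -
    define y where "y = (SOME y. y \<in> Z \<and> \<phi> y = \<phi> x)"
    have "y \<in> Z \<and> \<phi> y = \<phi> x" unfolding y_def by (rule someI[of _ x]) (use that in simp)
    then show ?thesis using that eq_iff H.eq_iff by (auto simp: \<psi>_def simp flip: y_def)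
  qed
  have "\<psi> \<in> hom G H" by (rule hom_into[OF H, of id]) (auto simp: \<psi>)
  moreover have "inj_on \<psi> (carrier G)"
    unfolding image_Z[symmetric] inj_on_def using \<psi> eq_iff H.eq_iff by auto
  moreover have "\<psi> ` carrier G = carrier H"
    unfolding image_Z[symmetric] H.image_Z[symmetric] image_image using \<psi> by auto
  ultimately show ?thesis by (auto simp: is_iso_def iso_def bij_betw_def)
qed

end

section \<open>Integral chains and faces of cubes\<close>

definition chains_on :: "'b set \<Rightarrow> ('b \<Rightarrow>\<^sub>0 int) set" where
  "chains_on S = {c. Poly_Mapping.keys c \<subseteq> S}"

lemma chains_closed: "add_closed (chains_on S)"
  unfolding add_closed_def chains_on_def using keys_diff by fastforce

lemmas chains_add = add_closed_add[OF chains_closed]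
  and chains_diff = add_closed_diff[OF chains_closed]
  and chains_minus = add_closed_minus[OF chains_closed]
  and chains_zero [simp] = add_closed_zero[OF chains_closed]

lemma frag_of_chains [simp]: "frag_of x \<in> chains_on S \<longleftrightarrow> x \<in> S"
  by (simp add: chains_on_def)

lemma chains_cmul: "c \<in> chains_on S \<Longrightarrow> frag_cmul k c \<in> chains_on S"
  unfolding chains_on_def using keys_cmul by blast

lemma chains_sum: "(\<And>i. i \<in> I \<Longrightarrow> f i \<in> chains_on S) \<Longrightarrow> sum f I \<in> chains_on S"
  by (induction I rule: infinite_finite_induct) (auto intro: chains_add)

lemma chains_mono: "S \<subseteq> T \<Longrightarrow> chains_on S \<subseteq> chains_on T"
  by (auto simp: chains_on_def)

lemma chains_Int: "chains_on (S \<inter> T) = chains_on S \<inter> chains_on T"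
  by (auto simp: chains_on_def)

lemma chains_empty [simp]: "chains_on {} = {0}"
  by (auto simp: chains_on_def)

lemma chains_induct [consumes 1, case_names zero one diff]:
  assumes "c \<in> chains_on S" "P 0" "\<And>x. x \<in> S \<Longrightarrow> P (frag_of x)"
    "\<And>a b. a \<in> chains_on S \<Longrightarrow> b \<in> chains_on S \<Longrightarrow> P a \<Longrightarrow> P b \<Longrightarrow> P (a - b)"
  shows "P c"
  using free_Abelian_group_induct[of c S P] assms by (auto simp: chains_on_def)

lemma frag_extend_chains:
  assumes "c \<in> chains_on S" "\<And>x. x \<in> S \<Longrightarrow> f x \<in> chains_on T"
  shows "frag_extend f c \<in> chains_on T"
  using assms(1) by (induction rule: chains_induct) (auto simp: frag_extend_diff assms(2) chains_diff)

text \<open>The sets may overlap, so the summands are not determined. Where a definite and additive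
  choice matters, \<open>frag_restrict\<close> takes over.\<close>

lemma chains_Un_split:
  assumes "c \<in> chains_on (S \<union> T)"
  obtains a b where "a \<in> chains_on S" "b \<in> chains_on T" "c = a + b"
proof -
  have "\<exists>a\<in>chains_on S. \<exists>b\<in>chains_on T. c = a + b"
    using assms
  proof (induction rule: chains_induct)
    case zero
    then show ?case by (metis add.right_neutral chains_zero)
  next
    case (one x)
    then show ?case
      by (metis UnE add.left_neutral add.right_neutral chains_zero frag_of_chains)
  next
    case (diff c c')
    then obtain a b a' b' where "a \<in> chains_on S" "b \<in> chains_on T" "c = a + b"
      "a' \<in> chains_on S" "b' \<in> chains_on T" "c' = a' + b'" by blast
    then show ?case
      by (intro bexI[of _ "a - a'"] bexI[of _ "b - b'"]) (auto intro: chains_diff)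
  qed
  then show thesis using that by blast
qed

section \<open>Faces of cubes through insertion into argument lists\<close>

abbreviation ins :: "nat \<Rightarrow> 'b \<Rightarrow> 'b list \<Rightarrow> 'b list" where
  "ins i s t \<equiv> take i t @ s # drop i t"

text \<open>An insertion at a position i \<le> j moves the later slot j to Suc j. The cubical
  identity \<open>cube_face_face\<close> is this fact read on cubes.\<close>

lemma ins_ins:
  assumes "i \<le> j" "j \<le> length t"
  shows "ins i s (ins j r t) = ins (Suc j) r (ins i s t)"
  using assms
proof (induction i arbitrary: j t)
  case (Suc i)
  then obtain j' a u where "j = Suc j'" "t = a # u" by (metis Suc_le_D length_Suc_conv)
  then show ?case using Suc.IH[of j' u] Suc.prems by simp
qed simp

lemma ins_update:
  assumes "i \<le> length t" "k < length t"
  shows "ins i s (t[k := r]) = (ins i s t)[(if k < i then k else Suc k) := r]"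
  using assms
proof (induction i arbitrary: k t)
  case (Suc i)
  then obtain a u where t: "t = a # u" by (cases t) auto
  show ?case
  proof (cases k)
    case 0
    then show ?thesis using t by simp
  next
    case (Suc k')
    then show ?thesis using Suc.IH[of u k'] Suc.prems t by simp
  qed
qed simp

lemma ins_unit_cube:
  assumes "t \<in> unit_cube n" "i \<le> n" "s \<in> {0, 1}"
  shows "ins i s t \<in> unit_cube (Suc n)"
  using assms by (auto simp: unit_cube_def dest: in_set_takeD in_set_dropD)

lemma unit_cube_nth: "t \<in> unit_cube n \<Longrightarrow> i < n \<Longrightarrow> t ! i \<in> {0, 1}"
  unfolding unit_cube_def using nth_mem by blast

lemma update_unit_cube:
  assumes "t \<in> unit_cube n" "s \<in> {0, 1}"
  shows "t[i := s] \<in> unit_cube n"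
  using assms set_update_subset_insert[of t i s] by (auto simp: unit_cube_def)

lemma c_adj_1_update:
  assumes "t \<in> unit_cube n" "s \<in> {0, 1}" "t \<noteq> t[k := s]"
  shows "c_adj 1 t (t[k := s])"
proof -
  have k: "k < length t" using assms(3) by (metis list_update_beyond not_less)
  have ti: "t ! i \<in> {0, 1}" if "i < length t" for i
    using unit_cube_nth[OF assms(1), of i] assms(1) that by (simp add: unit_cube_def)
  have "t ! i = t[k := s] ! i \<or> \<bar>t ! i - t[k := s] ! i\<bar> = 1" if "i < length t" for i
    using ti[OF that] that assms(2) by (cases "i = k") auto
  moreover have "{i. i < length t \<and> t ! i \<noteq> t[k := s] ! i} \<subseteq> {k}"
    by (intro subsetI, rule ccontr) simp
  then have "card {i. i < length t \<and> t ! i \<noteq> t[k := s] ! i} \<le> 1"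
    using card_mono[of "{k}"] by fastforce
  ultimately show ?thesis using assms(3) by (simp add: c_adj_def)
qed

lemma c_adj_1_unit_cubeE:
  assumes "c_adj 1 t t'" "t' \<in> unit_cube n"
  obtains k s where "k < n" "s \<in> {0, 1}" "t' = t[k := s]"
proof -
  let ?D = "{i. i < length t \<and> t ! i \<noteq> t' ! i}"
  have len: "length t = n" "length t' = n" using assms by (auto simp: c_adj_def unit_cube_def)
  have "t \<noteq> t'" "card ?D \<le> 1" using assms(1) by (auto simp: c_adj_def)
  then obtain k where k: "k < n" "t ! k \<noteq> t' ! k" using len by (metis nth_equalityI)
  have "?D = {k}" 
    by (rule sym, rule card_seteq) (use k len \<open>card ?D \<le> 1\<close> in auto)
  then have "t ! i = t' ! i" if "i < n" "i \<noteq> k" for i using that len by blast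
  then have "t' = t[k := t' ! k]"
    using len k(1) by (intro nth_equalityI) (auto simp: nth_list_update)
  moreover have "t' ! k \<in> {0, 1}"
    using assms(2) k(1) by (rule unit_cube_nth)
  ultimately show thesis using k that by blast
qed

text \<open>In the unit cube, \<open>c_adj 1\<close> relates exactly the points that differ in a
  single coordinate, so continuity is a condition on edges. List updates replace the adjacency of
  the cube from here on; an update that changes nothing falls under the equality.\<close>

lemma digital_cube_iff:
  "digital_cube n \<kappa> X T \<longleftrightarrow> T \<in> extensional (unit_cube n) \<and>
     (\<forall>t\<in>unit_cube n. T t \<in> X \<and>
        (\<forall>k<n. \<forall>s\<in>{0, 1}. T t = T (t[k := s]) \<or> \<kappa> (T t) (T (t[k := s]))))" (is "?L \<longleftrightarrow> ?R")
proof
  assume L: ?L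
  have "T t = T (t[k := s]) \<or> \<kappa> (T t) (T (t[k := s]))"
    if "t \<in> unit_cube n" "s \<in> {0, 1}" for t k s
    using L c_adj_1_update[OF that, of k] update_unit_cube[OF that, of k] that
    by (cases "t = t[k := s]") (auto simp: digital_cube_def dig_continuous_def)
  then show ?R using L by (auto simp: digital_cube_def dig_continuous_def)
next
  assume R: ?R
  have "T t = T t' \<or> \<kappa> (T t) (T t')"
    if "t \<in> unit_cube n" "t' \<in> unit_cube n" "c_adj 1 t t'" for t t'
    using R c_adj_1_unit_cubeE[OF that(3,2)] that by metis
  then show ?L using R by (auto simp: digital_cube_def dig_continuous_def)
qed

lemma digital_cube_subset:
  "A \<subseteq> X \<Longrightarrow> digital_cube n \<kappa> A T \<longleftrightarrow> digital_cube n \<kappa> X T \<and> T ` unit_cube n \<subseteq> A"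
  by (auto simp: digital_cube_iff)

lemma cube_face_apply:
  "t \<in> unit_cube n \<Longrightarrow> cube_face (Suc n) (Suc i) s T t = T (ins i s t)"
  by (simp add: cube_face_def)

lemma cube_face_extensional: "cube_face (Suc n) i s T \<in> extensional (unit_cube n)"
  by (simp add: cube_face_def)

lemma digital_cube_face:
  assumes T: "digital_cube (Suc n) \<kappa> X T" and "i \<le> n" "s \<in> {0, 1}"
  shows "digital_cube n \<kappa> X (cube_face (Suc n) (Suc i) s T)"
  unfolding digital_cube_iff
proof (intro conjI ballI allI impI)
  fix t assume t: "t \<in> unit_cube n"
  have len: "length t = n" using t by (simp add: unit_cube_def)
  have it: "ins i s t \<in> unit_cube (Suc n)" using ins_unit_cube[OF t] assms by blast
  show "cube_face (Suc n) (Suc i) s T t \<in> X"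
    using T it t by (auto simp: digital_cube_iff cube_face_apply)
  fix k r assume kr: "k < n" "r \<in> {0, 1::int}"
  define k' where "k' = (if k < i then k else Suc k)"
  have "k' < Suc n" using kr by (auto simp: k'_def)
  then have "T (ins i s t) = T ((ins i s t)[k' := r]) \<or> \<kappa> (T (ins i s t)) (T ((ins i s t)[k' := r]))"
    using T it kr(2) unfolding digital_cube_iff by blast
  then show "cube_face (Suc n) (Suc i) s T t = cube_face (Suc n) (Suc i) s T (t[k := r])
      \<or> \<kappa> (cube_face (Suc n) (Suc i) s T t) (cube_face (Suc n) (Suc i) s T (t[k := r]))"
    using t update_unit_cube[OF t kr(2)] assms(2) kr(1) len
    by (simp add: cube_face_apply ins_update k'_def)
qed (rule cube_face_extensional)

section \<open>The boundary squares to zero\<close>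

lemma cube_boundary_alt:
  "cube_boundary n T = (\<Sum>i<n. frag_cmul ((-1) ^ Suc i)
     (frag_of (cube_face n (Suc i) 0 T) - frag_of (cube_face n (Suc i) 1 T)))"
  unfolding cube_boundary_def
  by (rule sum.reindex_bij_witness[of _ Suc "\<lambda>i. i - 1"]) auto

lemma cube_boundary_0 [simp]: "cube_boundary 0 T = 0"
  by (simp add: cube_boundary_def)

lemma cube_face_face:
  assumes "i \<le> j" "j \<le> m" "s \<in> {0, 1}" "r \<in> {0, 1}"
  shows "cube_face (Suc m) (Suc j) r (cube_face (Suc (Suc m)) (Suc i) s T)
       = cube_face (Suc m) (Suc i) s (cube_face (Suc (Suc m)) (Suc (Suc j)) r T)"
proof (rule extensionalityI[OF cube_face_extensional cube_face_extensional])
  fix t assume t: "t \<in> unit_cube m"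
  then have "length t = m" by (simp add: unit_cube_def)
  then show "cube_face (Suc m) (Suc j) r (cube_face (Suc (Suc m)) (Suc i) s T) t
       = cube_face (Suc m) (Suc i) s (cube_face (Suc (Suc m)) (Suc (Suc j)) r T) t"
    using ins_ins[of i j t r s] assms ins_unit_cube[OF t, of j r] ins_unit_cube[OF t, of i s]
    by (simp add: cube_face_apply[OF t] cube_face_apply del: take_append drop_append append_take_drop_id)
qed

text \<open>The map from (i, j) to (j + 1, i) matches the index pairs with i \<le> j to those with i
  > j. In the induction the new column j = m cancels the new row i = m + 1.\<close>

lemma sum_antisym_eq_0:
  fixes g :: "nat \<Rightarrow> nat \<Rightarrow> 'b::ab_group_add"
  assumes "\<And>i j. i \<le> j \<Longrightarrow> j < m \<Longrightarrow> g i j = - g (Suc j) i"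
  shows "(\<Sum>i<Suc m. \<Sum>j<m. g i j) = 0"
  using assms
proof (induction m)
  case (Suc m)
  have "(\<Sum>i<Suc (Suc m). \<Sum>j<Suc m. g i j)
      = (\<Sum>i<Suc m. \<Sum>j<m. g i j) + (\<Sum>i<Suc m. g i m) + (\<Sum>j<Suc m. g (Suc m) j)"
    by (simp add: sum.distrib algebra_simps)
  also have "(\<Sum>i<Suc m. g i m) = - (\<Sum>j<Suc m. g (Suc m) j)"
    unfolding sum_negf[symmetric] by (rule sum.cong) (auto intro!: Suc.prems)
  also have "(\<Sum>i<Suc m. \<Sum>j<m. g i j) = 0"
    by (rule Suc.IH) (use Suc.prems in auto)
  finally show ?case by (simp only: add.left_inverse add_0)
qed simp

lemma frag_cmul_diff_distrib2: "frag_cmul k (a - b) = frag_cmul k a - frag_cmul k b"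
  by (rule poly_mapping_eqI) (simp add: lookup_minus algebra_simps)

lemma cube_boundary_boundary:
  "frag_extend (cube_boundary n) (cube_boundary (Suc n) T) = 0"
proof (cases n)
  case 0
  then show ?thesis by (simp add: cube_boundary_def frag_extend_eq_0)
next
  case (Suc m)
  define G where "G i s j r = frag_of (cube_face n (Suc j) r (cube_face (Suc n) (Suc i) s T))" for i s j r
  \<comment> \<open>The signs (-1)^(i+1) and (-1)^(j+1) multiply to (-1)^(i+j). The bracket is
    symmetric in the two inserted values, so exchanging the two directions alters only the
    sign.\<close>
  define g where "g i j = frag_cmul ((-1) ^ (i + j))
    (G i 0 j 0 - G i 0 j 1 - (G i 1 j 0 - G i 1 j 1))" for i j
  have "frag_extend (cube_boundary n) (cube_boundary (Suc n) T) = (\<Sum>i<Suc n. \<Sum>j<n. g i j)"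
  proof -
    have "frag_cmul ((-1) ^ Suc i) (cube_boundary n (cube_face (Suc n) (Suc i) 0 T)
        - cube_boundary n (cube_face (Suc n) (Suc i) 1 T)) = (\<Sum>j<n. g i j)" for i
      unfolding cube_boundary_alt[of n] sum_subtractf[symmetric] frag_cmul_sum
      by (simp add: g_def G_def power_add frag_cmul_diff_distrib2[symmetric] o_def)
    then show ?thesis
      unfolding cube_boundary_alt[of "Suc n"]
      by (simp only: frag_extend_sum finite_lessThan)
         (simp add: frag_extend_cmul frag_extend_diff o_def del: sum.lessThan_Suc)
  qed
  also have "\<dots> = 0"
  proof (rule sum_antisym_eq_0)
    fix i j assume ij: "i \<le> j" "j < n"
    then have "G i s j r = G (Suc j) r i s" if "s \<in> {0, 1}" "r \<in> {0, 1}" for s r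
      using cube_face_face[of i j m s r T] that Suc by (simp add: G_def)
    then have "g i j = frag_cmul ((-1) ^ (i + j))
      (G (Suc j) 0 i 0 - G (Suc j) 0 i 1 - (G (Suc j) 1 i 0 - G (Suc j) 1 i 1))"
      by (simp add: g_def algebra_simps)
    then show "g i j = - g (Suc j) i" by (simp add: g_def add.commute)
  qed
  finally show ?thesis .
qed

section \<open>Degenerate cubes, images and prisms\<close>

text \<open>Removing coordinate i renumbers the idle direction k as k' and leaves it idle. For i = k
  the idle direction itself is removed, a case that \<open>degenerate_boundary\<close> settles by
  cancellation.\<close>

lemma degenerate_face:
  assumes k: "k \<le> n" "\<And>t s. t \<in> unit_cube (Suc n) \<Longrightarrow> s \<in> {0, 1} \<Longrightarrow> T (t[k := s]) = T t"
    and i: "i \<le> n" "i \<noteq> k" "s \<in> {0, 1}"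
  shows "degenerate_cube n (cube_face (Suc n) (Suc i) s T)"
proof -
  define k' where "k' = (if k < i then k else k - 1)"
  have k': "k' < n" "k = (if k' < i then k' else Suc k')" using k(1) i(1,2) by (auto simp: k'_def)
  have "cube_face (Suc n) (Suc i) s T (t[k' := r]) = cube_face (Suc n) (Suc i) s T t"
    if t: "t \<in> unit_cube n" and r: "r \<in> {0, 1}" for t r
  proof -
    have "length t = n" using t by (simp add: unit_cube_def)
    then have "ins i s (t[k' := r]) = (ins i s t)[k := r]"
      using ins_update[of i t k' r s] i(1) k' by simp
    then show ?thesis
      using k(2)[OF ins_unit_cube[OF t i(1,3)] r]
      by (simp add: cube_face_apply[OF t] cube_face_apply[OF update_unit_cube[OF t r]])
  qed
  then show ?thesis using k'(1) by (auto simp: degenerate_cube_def)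
qed

text \<open>In the idle direction the two opposite faces coincide and cancel; in every other
  direction both faces are degenerate. Hence degenerate chains form a subcomplex.\<close>

lemma degenerate_boundary:
  assumes T: "digital_cube n \<kappa> X T" and deg: "degenerate_cube n T"
  shows "cube_boundary n T \<in> chains_on {S. digital_cube (n - 1) \<kappa> X S \<and> degenerate_cube (n - 1) S}"
proof -
  obtain k where k: "k < n" "\<And>t s. t \<in> unit_cube n \<Longrightarrow> s \<in> {0, 1} \<Longrightarrow> T (t[k := s]) = T t"
    using deg unfolding degenerate_cube_def by blast
  then obtain m where n: "n = Suc m" by (cases n) auto
  have "frag_of (cube_face n (Suc i) 0 T) - frag_of (cube_face n (Suc i) 1 T)
      \<in> chains_on {S. digital_cube m \<kappa> X S \<and> degenerate_cube m S}" if i: "i \<le> m" for i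
  proof (cases "i = k")
    case True
    have "cube_face n (Suc i) 0 T = cube_face n (Suc i) 1 T"
      unfolding n
    proof (rule extensionalityI[OF cube_face_extensional cube_face_extensional])
      fix t assume t: "t \<in> unit_cube m"
      then have "(ins k 0 t)[k := 1] = ins k 1 t"
        using k(1) n by (simp add: unit_cube_def list_update_append min_def)
      then show "cube_face (Suc m) (Suc i) 0 T t = cube_face (Suc m) (Suc i) 1 T t"
        using k(2)[of "ins k 0 t" 1] ins_unit_cube[OF t, of k 0] i True n t
        by (simp add: cube_face_apply)
    qed
    then show ?thesis by simp
  next
    case False
    have "cube_face n (Suc i) s T \<in> {S. digital_cube m \<kappa> X S \<and> degenerate_cube m S}"
      if "s \<in> {0, 1}" for s
      using degenerate_face[of k m T i s] digital_cube_face[of m \<kappa> X T i s] T k n that i False by auto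
    then show ?thesis by (intro chains_diff) auto
  qed
  then show ?thesis unfolding cube_boundary_alt n by (intro chains_sum chains_cmul) auto
qed

lemma boundary_chains_on:
  assumes "digital_cube n \<kappa> X T"
  shows "cube_boundary n T \<in> chains_on {S. digital_cube (n - 1) \<kappa> X S}"
proof (cases n)
  case (Suc m)
  then show ?thesis
    using digital_cube_face[of m \<kappa> X T] assms unfolding cube_boundary_alt
    by (intro chains_sum chains_cmul chains_diff) auto
qed simp

section \<open>Composition of cubes with a map\<close>

abbreviation push_cube :: "nat \<Rightarrow> ('a \<Rightarrow> 'b) \<Rightarrow> 'a cube \<Rightarrow> 'b cube" where
  "push_cube n f T \<equiv> restrict (f \<circ> T) (unit_cube n)"

lemma digital_cube_push:
  assumes "dig_continuous \<kappa> X \<nu> Y f" "digital_cube n \<kappa> X T"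
  shows "digital_cube n \<nu> Y (push_cube n f T)"
  unfolding digital_cube_iff
proof (intro conjI ballI allI impI)
  fix t assume t: "t \<in> unit_cube n"
  have Tt: "T u \<in> X" if "u \<in> unit_cube n" for u
    using assms(2) that by (simp add: digital_cube_iff)
  show "push_cube n f T t \<in> Y" using assms(1) Tt[OF t] t by (auto simp: dig_continuous_def)
  fix k s assume ks: "k < n" "s \<in> {0, 1::int}"
  have u: "t[k := s] \<in> unit_cube n" using update_unit_cube[OF t ks(2)] .
  have "T t = T (t[k := s]) \<or> \<kappa> (T t) (T (t[k := s]))"
    using assms(2) t ks unfolding digital_cube_iff by blast
  then have "f (T t) = f (T (t[k := s])) \<or> \<nu> (f (T t)) (f (T (t[k := s])))"
    using assms(1) Tt[OF t] Tt[OF u] unfolding dig_continuous_def by metis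
  then show "push_cube n f T t = push_cube n f T (t[k := s])
      \<or> \<nu> (push_cube n f T t) (push_cube n f T (t[k := s]))"
    using t u by simp
qed simp

lemma degenerate_push:
  assumes "degenerate_cube n T"
  shows "degenerate_cube n (push_cube n f T)"
proof -
  obtain k where k: "k < n" "\<And>t s. t \<in> unit_cube n \<Longrightarrow> s \<in> {0, 1} \<Longrightarrow> T (t[k := s]) = T t"
    using assms unfolding degenerate_cube_def by blast
  have "push_cube n f T (t[k := s]) = push_cube n f T t" if t: "t \<in> unit_cube n" and s: "s \<in> {0, 1}" for t s
    using k(2)[OF t s] update_unit_cube[OF t s, of k] t by simp
  then show ?thesis using k(1) unfolding degenerate_cube_def by blast
qed

lemma face_push:
  assumes "i \<le> n" "s \<in> {0, 1}"
  shows "cube_face (Suc n) (Suc i) s (push_cube (Suc n) f T) = push_cube n f (cube_face (Suc n) (Suc i) s T)"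
proof (rule extensionalityI[OF cube_face_extensional])
  fix t assume t: "t \<in> unit_cube n"
  then show "cube_face (Suc n) (Suc i) s (push_cube (Suc n) f T) t
      = push_cube n f (cube_face (Suc n) (Suc i) s T) t"
    using ins_unit_cube[OF t assms] by (simp add: cube_face_apply)
qed simp

lemma boundary_push:
  "cube_boundary n (push_cube n f T)
     = frag_extend (\<lambda>S. frag_of (push_cube (n - 1) f S)) (cube_boundary n T)"
proof (cases n)
  case (Suc m)
  show ?thesis
    unfolding cube_boundary_alt Suc
    by (simp only: frag_extend_sum finite_lessThan)
       (auto simp: frag_extend_cmul frag_extend_diff face_push[unfolded o_def] o_def simp del: sum.lessThan_Suc intro!: sum.cong)
qed simp

section \<open>Prisms over cubes\<close>

lemma unit_cube_Cons: "t \<in> unit_cube (Suc n) \<longleftrightarrow> (\<exists>s u. t = s # u \<and> s \<in> {0, 1} \<and> u \<in> unit_cube n)"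
  by (cases t) (auto simp: unit_cube_def)

text \<open>The homotopy coordinate comes first, so all faces in the other directions are shifted by
  exactly one position and acquire the same change of sign.\<close>

definition prism :: "nat \<Rightarrow> ('a \<Rightarrow> 'b) \<Rightarrow> ('a \<Rightarrow> 'b) \<Rightarrow> 'a cube \<Rightarrow> 'b cube" where
  "prism n f g T = restrict (\<lambda>t. (if hd t = 0 then f else g) (T (tl t))) (unit_cube (Suc n))"

lemma prism_Cons:
  "u \<in> unit_cube n \<Longrightarrow> s \<in> {0, 1} \<Longrightarrow> prism n f g T (s # u) = (if s = 0 then f else g) (T u)"
  by (simp add: prism_def unit_cube_Cons)

text \<open>Edges change one coordinate at a time, so f x is compared with g x only, never with g at
  a neighbour of x. Adjacency is asked in both directions because \<open>digital_cube_iff\<close>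
  runs along each edge both ways.\<close>

lemma digital_cube_prism:
  assumes f: "dig_continuous \<kappa> X \<nu> Y f" and g: "dig_continuous \<kappa> X \<nu> Y g"
    and fg: "\<And>x. x \<in> X \<Longrightarrow> f x = g x \<or> \<nu> (f x) (g x) \<and> \<nu> (g x) (f x)"
    and T: "digital_cube n \<kappa> X T"
  shows "digital_cube (Suc n) \<nu> Y (prism n f g T)"
  unfolding digital_cube_iff
proof (intro conjI ballI allI impI)
  show "prism n f g T \<in> extensional (unit_cube (Suc n))" by (simp add: prism_def)
  fix t assume t: "t \<in> unit_cube (Suc n)"
  then obtain r u where t_eq: "t = r # u" and r: "r \<in> {0, 1}" and u: "u \<in> unit_cube n"
    by (auto simp: unit_cube_Cons)
  have Tv: "T v \<in> X" if "v \<in> unit_cube n" for v using T that by (simp add: digital_cube_iff)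
  define F where "F s = (if s = 0 then f else g)" for s :: int
  have F: "dig_continuous \<kappa> X \<nu> Y (F s)" for s using f g by (simp add: F_def)
  have FF: "F s x = F s' x \<or> \<nu> (F s x) (F s' x)" if "x \<in> X" for s s' x
    using fg[OF that] by (auto simp: F_def)
  have P: "prism n f g T (s # v) = F s (T v)" if "s \<in> {0, 1}" "v \<in> unit_cube n" for s v
    using prism_Cons[OF that(2,1), of f g T] by (simp only: F_def)
  show "prism n f g T t \<in> Y" using F[of r] Tv[OF u] P[OF r u] t_eq by (auto simp: dig_continuous_def)
  fix k s assume ks: "k < Suc n" "s \<in> {0, 1::int}"
  show "prism n f g T t = prism n f g T (t[k := s]) \<or> \<nu> (prism n f g T t) (prism n f g T (t[k := s]))"
  proof (cases k)
    case 0
    then show ?thesis using FF[OF Tv[OF u], of r s] P[OF r u] P[OF ks(2) u] t_eq by simp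
  next
    case (Suc k')
    have u': "u[k' := s] \<in> unit_cube n" using update_unit_cube[OF u ks(2)] .
    have "T u = T (u[k' := s]) \<or> \<kappa> (T u) (T (u[k' := s]))"
      using T u ks Suc unfolding digital_cube_iff by blast
    then have "F r (T u) = F r (T (u[k' := s])) \<or> \<nu> (F r (T u)) (F r (T (u[k' := s])))"
      using F[of r] Tv[OF u] Tv[OF u'] unfolding dig_continuous_def by metis
    then show ?thesis using P[OF r u] P[OF r u'] t_eq Suc by simp
  qed
qed

lemma degenerate_prism:
  assumes "degenerate_cube n T"
  shows "degenerate_cube (Suc n) (prism n f g T)"
proof -
  obtain k where k: "k < n" "\<And>t s. t \<in> unit_cube n \<Longrightarrow> s \<in> {0, 1} \<Longrightarrow> T (t[k := s]) = T t"
    using assms unfolding degenerate_cube_def by blast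
  have "prism n f g T (t[Suc k := s]) = prism n f g T t" if t: "t \<in> unit_cube (Suc n)" and s: "s \<in> {0, 1}" for t s
  proof -
    obtain r u where "t = r # u" "r \<in> {0, 1}" "u \<in> unit_cube n" using t by (auto simp: unit_cube_Cons)
    then show ?thesis using update_unit_cube[of u n s k] s k(2)[of u s] by (simp add: prism_Cons)
  qed
  then show ?thesis using k(1) unfolding degenerate_cube_def by (intro exI[of _ "Suc k"]) auto
qed

lemma face_prism_0:
  assumes "s \<in> {0, 1}"
  shows "cube_face (Suc n) (Suc 0) s (prism n f g T) = push_cube n (if s = 0 then f else g) T"
proof (rule extensionalityI[OF cube_face_extensional])
  fix t assume "t \<in> unit_cube n"
  then show "cube_face (Suc n) (Suc 0) s (prism n f g T) t = push_cube n (if s = 0 then f else g) T t"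
    using assms by (simp add: cube_face_apply prism_Cons)
qed simp

lemma face_prism_Suc:
  assumes "i \<le> n" "s \<in> {0, 1}"
  shows "cube_face (Suc (Suc n)) (Suc (Suc i)) s (prism (Suc n) f g T)
    = prism n f g (cube_face (Suc n) (Suc i) s T)"
proof (rule extensionalityI[OF cube_face_extensional])
  fix t assume t: "t \<in> unit_cube (Suc n)"
  then obtain r u where "t = r # u" "r \<in> {0, 1}" "u \<in> unit_cube n" by (auto simp: unit_cube_Cons)
  then show "cube_face (Suc (Suc n)) (Suc (Suc i)) s (prism (Suc n) f g T) t
      = prism n f g (cube_face (Suc n) (Suc i) s T) t"
    using ins_unit_cube[of u n i s] t assms by (simp add: cube_face_apply prism_Cons)
qed (simp add: prism_def)

text \<open>The two faces in the homotopy direction carry the sign of the first coordinate and give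
  g minus f. The others are prisms over the faces of T, with opposite sign because of the shift by
  one.\<close>

lemma boundary_prism:
  "cube_boundary (Suc n) (prism n f g T)
     = frag_of (push_cube n g T) - frag_of (push_cube n f T)
       - frag_extend (\<lambda>S. frag_of (prism (n - 1) f g S)) (cube_boundary n T)"
proof -
  have "frag_extend (\<lambda>S. frag_of (prism (n - 1) f g S)) (cube_boundary n T)
    = (\<Sum>i<n. frag_cmul ((-1) ^ Suc i)
         (frag_of (cube_face (Suc n) (Suc (Suc i)) 0 (prism n f g T))
          - frag_of (cube_face (Suc n) (Suc (Suc i)) 1 (prism n f g T))))"
  proof (cases n)
    case (Suc m)
    show ?thesis
      unfolding cube_boundary_alt Suc
      by (simp only: frag_extend_sum finite_lessThan)
         (auto simp: frag_extend_cmul frag_extend_diff face_prism_Suc o_def simp del: sum.lessThan_Suc intro!: sum.cong)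
  qed simp
  then show ?thesis
    unfolding cube_boundary_alt[of "Suc n"] sum.lessThan_Suc_shift
    by (simp add: face_prism_0 sum_negf[symmetric])
qed

text \<open>The coordinates are changed one after the other.\<close>

lemma cube_path:
  assumes T: "digital_cube n \<kappa> X T" and s: "s \<in> unit_cube n" and t: "t \<in> unit_cube n"
  shows "(T s, T t) \<in> {(x, y). x \<in> X \<and> y \<in> X \<and> (x = y \<or> \<kappa> x y)} ^^ n"
proof -
  let ?R = "{(x, y). x \<in> X \<and> y \<in> X \<and> (x = y \<or> \<kappa> x y)}"
  define u where "u k = take k t @ drop k s" for k
  have len: "length s = n" "length t = n" using s t by (auto simp: unit_cube_def)
  have u: "u k \<in> unit_cube n" for k
    using s t len by (auto simp: u_def unit_cube_def dest: in_set_takeD in_set_dropD)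
  have "(T (u 0), T (u k)) \<in> ?R ^^ k" if "k \<le> n" for k
    using that
  proof (induction k)
    case (Suc k)
    then have k: "k < n" by simp
    have "u (Suc k) = (u k)[k := t ! k]"
      using len k by (simp add: u_def take_Suc_conv_app_nth list_update_append Cons_nth_drop_Suc[symmetric])
    then have "T (u k) = T (u (Suc k)) \<or> \<kappa> (T (u k)) (T (u (Suc k)))"
      using T u[of k] unit_cube_nth[OF t k] k unfolding digital_cube_iff by metis
    moreover have "T (u i) \<in> X" for i using T u by (simp add: digital_cube_iff)
    ultimately have "(T (u k), T (u (Suc k))) \<in> ?R" by simp
    then show ?case using Suc by auto
  qed simp
  from this[of n] show ?thesis using len by (simp add: u_def)
qed

section \<open>A chain-level presentation of relative homology\<close>

text \<open>Since \<open>nat n\<close> is 0 for negative n, the guard keeps 0-cubes from reappearing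
  in negative degrees.\<close>

definition cubes :: "int \<Rightarrow> ('a \<Rightarrow> 'a \<Rightarrow> bool) \<Rightarrow> 'a set \<Rightarrow> 'a cube set" where
  "cubes n \<kappa> X = {T. 0 \<le> n \<and> digital_cube (nat n) \<kappa> X T}"

definition degenerate_cubes :: "int \<Rightarrow> ('a \<Rightarrow> 'a \<Rightarrow> bool) \<Rightarrow> 'a set \<Rightarrow> 'a cube set" where
  "degenerate_cubes n \<kappa> X = {T \<in> cubes n \<kappa> X. degenerate_cube (nat n) T}"

text \<open>For A \<subseteq> X these cubes generate the kernel of the projection from
  \<open>dQ n \<kappa> X\<close> to \<open>dC_rel n \<kappa> X A\<close>.\<close>

definition rel_cubes :: "int \<Rightarrow> ('a \<Rightarrow> 'a \<Rightarrow> bool) \<Rightarrow> 'a set \<Rightarrow> 'a set \<Rightarrow> 'a cube set" where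
  "rel_cubes n \<kappa> X A = cubes n \<kappa> A \<union> degenerate_cubes n \<kappa> X"

definition cycles :: "int \<Rightarrow> ('a \<Rightarrow> 'a \<Rightarrow> bool) \<Rightarrow> 'a set \<Rightarrow> 'a set \<Rightarrow> 'a cube_chain set" where
  "cycles n \<kappa> X A =
     {c \<in> chains_on (cubes n \<kappa> X). dQ_boundary n c \<in> chains_on (rel_cubes (n - 1) \<kappa> X A)}"

text \<open>For A \<subseteq> X these are all representatives of zero: boundaries of (n+1)-chains of
  X, plus chains of A, plus degenerate chains of X.\<close>

definition boundaries :: "int \<Rightarrow> ('a \<Rightarrow> 'a \<Rightarrow> bool) \<Rightarrow> 'a set \<Rightarrow> 'a set \<Rightarrow> 'a cube_chain set" where
  "boundaries n \<kappa> X A =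
     {c. \<exists>b\<in>chains_on (cubes (n + 1) \<kappa> X). c - dQ_boundary (n + 1) b \<in> chains_on (rel_cubes n \<kappa> X A)}"

lemma degenerate_cubes_subset: "degenerate_cubes n \<kappa> X \<subseteq> cubes n \<kappa> X"
  by (auto simp: degenerate_cubes_def)

lemma cubes_mono: "A \<subseteq> X \<Longrightarrow> cubes n \<kappa> A \<subseteq> cubes n \<kappa> X"
  by (auto simp: cubes_def digital_cube_subset)

lemma cubes_empty [simp]: "cubes n \<kappa> {} = {}"
proof -
  have "replicate (nat n) 0 \<in> unit_cube (nat n)" by (auto simp: unit_cube_def)
  then show ?thesis by (auto simp: cubes_def digital_cube_iff)
qed

lemma cubes_neg [simp]: "n < 0 \<Longrightarrow> cubes n \<kappa> X = {}"
  by (simp add: cubes_def)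

lemma degenerate_cubes_Int: "A \<subseteq> X \<Longrightarrow> degenerate_cubes n \<kappa> X \<inter> cubes n \<kappa> A = degenerate_cubes n \<kappa> A"
  using cubes_mono[of A X n \<kappa>] by (auto simp: degenerate_cubes_def)

lemma degenerate_cubes_mono: "A \<subseteq> X \<Longrightarrow> degenerate_cubes n \<kappa> A \<subseteq> degenerate_cubes n \<kappa> X"
  using cubes_mono[of A X n \<kappa>] by (auto simp: degenerate_cubes_def)

lemma dQ_boundary_diff: "dQ_boundary n (a - b) = dQ_boundary n a - dQ_boundary n b"
  by (simp add: dQ_boundary_def frag_extend_diff)

lemma dQ_boundary_add: "dQ_boundary n (a + b) = dQ_boundary n a + dQ_boundary n b"
  by (simp add: dQ_boundary_def frag_extend_add)

lemma dQ_boundary_0 [simp]: "dQ_boundary n 0 = 0"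
  by (simp add: dQ_boundary_def)

lemma dQ_boundary_cubes:
  "c \<in> chains_on (cubes n \<kappa> X) \<Longrightarrow> dQ_boundary n c \<in> chains_on (cubes (n - 1) \<kappa> X)"
  unfolding dQ_boundary_def
proof (rule frag_extend_chains)
  fix T assume T: "T \<in> cubes n \<kappa> X"
  show "cube_boundary (nat n) T \<in> chains_on (cubes (n - 1) \<kappa> X)"
  proof (cases "n = 0")
    case False
    then show ?thesis
      using T boundary_chains_on[of "nat n" \<kappa> X T] by (simp add: cubes_def nat_diff_distrib')
  qed simp
qed

lemma dQ_boundary_degenerate:
  "c \<in> chains_on (degenerate_cubes n \<kappa> X) \<Longrightarrow> dQ_boundary n c \<in> chains_on (degenerate_cubes (n - 1) \<kappa> X)"
  unfolding dQ_boundary_def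
proof (rule frag_extend_chains)
  fix T assume T: "T \<in> degenerate_cubes n \<kappa> X"
  show "cube_boundary (nat n) T \<in> chains_on (degenerate_cubes (n - 1) \<kappa> X)"
  proof (cases "n = 0")
    case False
    then show ?thesis
      using T degenerate_boundary[of "nat n" \<kappa> X T]
      by (simp add: degenerate_cubes_def cubes_def nat_diff_distrib' conj_assoc)
  qed simp
qed

lemma dQ_boundary_boundary: "dQ_boundary (n - 1) (dQ_boundary n c) = 0"
proof (cases "n \<le> 0")
  case True
  then show ?thesis by (simp add: dQ_boundary_def frag_extend_eq_0)
next
  case False
  then obtain m where n: "nat n = Suc m" "nat (n - 1) = m" by (cases "nat n") auto
  have "c \<in> chains_on UNIV" by (simp add: chains_on_def)
  then show ?thesis
    unfolding dQ_boundary_def n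
    by (induction rule: chains_induct) (auto simp: frag_extend_diff cube_boundary_boundary)
qed

lemma dQ_boundary_boundary_Suc: "dQ_boundary n (dQ_boundary (n + 1) c) = 0"
  using dQ_boundary_boundary[of "n + 1" c] by simp

lemma rel_cubes_memE:
  assumes "c \<in> chains_on (rel_cubes n \<kappa> X A)"
  obtains a b where "a \<in> chains_on (cubes n \<kappa> A)" "b \<in> chains_on (degenerate_cubes n \<kappa> X)" "c = a + b"
  using assms unfolding rel_cubes_def by (rule chains_Un_split)

lemma rel_cubes_memI:
  assumes "a \<in> chains_on (cubes n \<kappa> A)" "c - a \<in> chains_on (degenerate_cubes n \<kappa> X)"
  shows "c \<in> chains_on (rel_cubes n \<kappa> X A)"
proof -
  have "a + (c - a) \<in> chains_on (rel_cubes n \<kappa> X A)"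
    using assms chains_mono[of "cubes n \<kappa> A" "rel_cubes n \<kappa> X A"]
      chains_mono[of "degenerate_cubes n \<kappa> X" "rel_cubes n \<kappa> X A"]
    by (intro chains_add) (auto simp: rel_cubes_def)
  then show ?thesis by simp
qed

section \<open>The iterated quotient, presented stage by stage\<close>

definition abs_coset :: "int \<Rightarrow> ('a \<Rightarrow> 'a \<Rightarrow> bool) \<Rightarrow> 'a set \<Rightarrow> 'a cube_chain \<Rightarrow> 'a cube_chain set" where
  "abs_coset n \<kappa> X c = dD n \<kappa> X #>\<^bsub>dQ n \<kappa> X\<^esub> c"

definition rel_coset ::
    "int \<Rightarrow> ('a \<Rightarrow> 'a \<Rightarrow> bool) \<Rightarrow> 'a set \<Rightarrow> 'a set \<Rightarrow> 'a cube_chain \<Rightarrow> 'a cube_chain set set" where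
  "rel_coset n \<kappa> X A c = dC_sub n \<kappa> X A #>\<^bsub>dC n \<kappa> X\<^esub> abs_coset n \<kappa> X c"

definition hclass ::
    "int \<Rightarrow> ('a \<Rightarrow> 'a \<Rightarrow> bool) \<Rightarrow> 'a set \<Rightarrow> 'a set \<Rightarrow> 'a cube_chain \<Rightarrow> 'a cube_chain set set set" where
  "hclass n \<kappa> X A c = dH_class n \<kappa> X A (abs_coset n \<kappa> X c)"

lemma hclass_eq: "hclass n \<kappa> X A c = dB n \<kappa> X A #>\<^bsub>dZ n \<kappa> X A\<^esub> rel_coset n \<kappa> X A c"
  by (simp add: hclass_def dH_class_def rel_coset_def)

lemma presentation_dQ: "presentation (dQ n \<kappa> X) (chains_on (cubes n \<kappa> X)) {0} (\<lambda>c. c)"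
proof -
  have dQ: "dQ n \<kappa> X = free_Abelian_group (cubes n \<kappa> X)" by (simp add: dQ_def cubes_def)
  interpret comm_group "dQ n \<kappa> X" unfolding dQ by (rule abelian_free_Abelian_group)
  show ?thesis
  proof
    show "(\<lambda>c. c) ` chains_on (cubes n \<kappa> X) = carrier (dQ n \<kappa> X)"
      by (auto simp: dQ chains_on_def)
  qed (use chains_closed in \<open>auto simp: dQ\<close>)
qed

text \<open>Written as an image under the identity, the subgroup has the shape of \<phi> applied to
  L that \<open>quotient\<close> and \<open>quot_map_coset\<close> expect, with \<phi> taken from
  \<open>presentation_dQ\<close>.\<close>

lemma dD_eq: "dD n \<kappa> X = (\<lambda>c. c) ` chains_on (degenerate_cubes n \<kappa> X)"
proof -
  interpret presentation "dQ n \<kappa> X" "chains_on (cubes n \<kappa> X)" "{0}" "\<lambda>c. c" by (rule presentation_dQ)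
  have D: "dD n \<kappa> X = generate (dQ n \<kappa> X) (frag_of ` degenerate_cubes n \<kappa> X)"
    unfolding dD_def degenerate_cubes_def cubes_def by (auto intro!: arg_cong[of _ _ "generate _"])
  have dQ: "dQ n \<kappa> X = free_Abelian_group (cubes n \<kappa> X)" by (simp add: dQ_def cubes_def)
  have sub: "subgroup (chains_on (degenerate_cubes n \<kappa> X)) (dQ n \<kappa> X)"
    using subgroup_image[OF chains_closed chains_mono[OF degenerate_cubes_subset]] by simp
  have "generate (dQ n \<kappa> X) (frag_of ` degenerate_cubes n \<kappa> X) \<subseteq> chains_on (degenerate_cubes n \<kappa> X)"
    by (rule generate_subgroup_incl[OF _ sub]) auto
  moreover have "c \<in> generate (dQ n \<kappa> X) (frag_of ` degenerate_cubes n \<kappa> X)"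
    if "c \<in> chains_on (degenerate_cubes n \<kappa> X)" for c
    using that
  proof (induction rule: chains_induct)
    case zero
    show ?case using generate.one[of "dQ n \<kappa> X"] by (simp add: dQ)
  next
    case (one T)
    then show ?case by (intro generate.incl) auto
  next
    case (diff a b)
    have "Poly_Mapping.keys b \<subseteq> cubes n \<kappa> X"
      using diff(2) degenerate_cubes_subset[of n \<kappa> X] by (auto simp: chains_on_def)
    then have inv: "inv\<^bsub>dQ n \<kappa> X\<^esub> b = - b" by (simp add: dQ)
    have "frag_of ` degenerate_cubes n \<kappa> X \<subseteq> carrier (dQ n \<kappa> X)"
      using degenerate_cubes_subset[of n \<kappa> X] by (auto simp: dQ)
    then have "inv\<^bsub>dQ n \<kappa> X\<^esub> b \<in> generate (dQ n \<kappa> X) (frag_of ` degenerate_cubes n \<kappa> X)"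
      using diff(4) by (rule generate_m_inv_closed)
    then have "a \<otimes>\<^bsub>dQ n \<kappa> X\<^esub> inv\<^bsub>dQ n \<kappa> X\<^esub> b \<in> generate (dQ n \<kappa> X) (frag_of ` degenerate_cubes n \<kappa> X)"
      using diff(3) by (rule generate.eng[rotated])
    then show ?case unfolding inv by (simp add: dQ)
  qed
  ultimately show ?thesis unfolding D by auto
qed

lemma presentation_dC:
  "presentation (dC n \<kappa> X) (chains_on (cubes n \<kappa> X)) (chains_on (degenerate_cubes n \<kappa> X)) (abs_coset n \<kappa> X)"
proof -
  interpret presentation "dQ n \<kappa> X" "chains_on (cubes n \<kappa> X)" "{0}" "\<lambda>c. c" by (rule presentation_dQ)
  show ?thesis
    unfolding dC_def abs_coset_def[abs_def] dD_eq
    by (rule quotient[OF chains_closed chains_mono[OF degenerate_cubes_subset]]) auto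
qed

lemma dC_incl_coset:
  assumes "A \<subseteq> X" "a \<in> chains_on (cubes n \<kappa> A)"
  shows "dC_incl n \<kappa> X (abs_coset n \<kappa> A a) = abs_coset n \<kappa> X a"
  unfolding dC_incl_def abs_coset_def dD_eq
  by (rule presentation.quot_map_coset[OF presentation_dQ presentation_dQ
        chains_closed chains_mono[OF degenerate_cubes_subset] chains_closed chains_mono[OF degenerate_cubes_subset]])
     (use assms chains_mono[OF cubes_mono[OF assms(1)], of n \<kappa>]
        chains_mono[OF degenerate_cubes_mono[OF assms(1)], of n \<kappa>]
        in auto)

lemma dC_sub_eq:
  assumes "A \<subseteq> X"
  shows "dC_sub n \<kappa> X A = abs_coset n \<kappa> X ` chains_on (cubes n \<kappa> A)"
  unfolding dC_sub_def presentation.image_Z[OF presentation_dC, symmetric] image_image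
  using dC_incl_coset[OF assms] by auto

lemma presentation_dC_rel:
  assumes "A \<subseteq> X"
  shows "presentation (dC_rel n \<kappa> X A) (chains_on (cubes n \<kappa> X)) (chains_on (rel_cubes n \<kappa> X A))
           (rel_coset n \<kappa> X A)"
  unfolding dC_rel_def rel_coset_def[abs_def] dC_sub_eq[OF assms]
proof (rule presentation.quotient[OF presentation_dC chains_closed chains_mono[OF cubes_mono[OF assms]]])
  fix c
  show "c \<in> chains_on (rel_cubes n \<kappa> X A) \<longleftrightarrow>
      (\<exists>a\<in>chains_on (cubes n \<kappa> A). c - a \<in> chains_on (degenerate_cubes n \<kappa> X))"
    by (metis rel_cubes_memE rel_cubes_memI add_diff_cancel_left')
qed

lemma dC_boundary_coset:
  assumes "c \<in> chains_on (cubes n \<kappa> X)"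
  shows "dC_boundary n \<kappa> X (abs_coset n \<kappa> X c) = abs_coset (n - 1) \<kappa> X (dQ_boundary n c)"
  unfolding dC_boundary_def abs_coset_def dD_eq
  by (rule presentation.quot_map_coset[OF presentation_dQ presentation_dQ
        chains_closed chains_mono[OF degenerate_cubes_subset] chains_closed chains_mono[OF degenerate_cubes_subset]])
     (use assms in \<open>auto simp: dQ_boundary_add intro: dQ_boundary_cubes dQ_boundary_degenerate\<close>)

lemma dC_rel_boundary_coset:
  assumes "A \<subseteq> X" "c \<in> chains_on (cubes n \<kappa> X)"
  shows "dC_rel_boundary n \<kappa> X A (rel_coset n \<kappa> X A c) = rel_coset (n - 1) \<kappa> X A (dQ_boundary n c)"
  unfolding dC_rel_boundary_def rel_coset_def dC_sub_eq[OF assms(1)]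
  by (rule presentation.quot_map_coset[OF presentation_dC presentation_dC
        chains_closed chains_mono[OF cubes_mono[OF assms(1)]] chains_closed chains_mono[OF cubes_mono[OF assms(1)]]])
     (use assms(2) in \<open>auto simp: dQ_boundary_add dC_boundary_coset intro: dQ_boundary_cubes\<close>)

lemma cycles_subset: "cycles n \<kappa> X A \<subseteq> chains_on (cubes n \<kappa> X)"
  by (auto simp: cycles_def)

lemma cycles_closed: "add_closed (cycles n \<kappa> X A)"
  by (auto simp: add_closed_def cycles_def dQ_boundary_diff intro: chains_diff)

text \<open>On representatives the kernel condition says that the boundary is a null chain one
  degree lower, which is how \<open>cycles\<close> is defined; the null chains are inherited from
  \<open>dC_rel\<close>.\<close>

lemma presentation_dZ:
  assumes "A \<subseteq> X"
  shows "presentation (dZ n \<kappa> X A) (cycles n \<kappa> X A) (chains_on (rel_cubes n \<kappa> X A)) (rel_coset n \<kappa> X A)"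
proof -
  interpret C: presentation "dC_rel n \<kappa> X A" "chains_on (cubes n \<kappa> X)" "chains_on (rel_cubes n \<kappa> X A)"
    "rel_coset n \<kappa> X A" using assms by (rule presentation_dC_rel)
  interpret C': presentation "dC_rel (n - 1) \<kappa> X A" "chains_on (cubes (n - 1) \<kappa> X)"
    "chains_on (rel_cubes (n - 1) \<kappa> X A)" "rel_coset (n - 1) \<kappa> X A" using assms by (rule presentation_dC_rel)
  show ?thesis
    unfolding dZ_def
  proof (rule C.restrict_carrier[OF cycles_closed cycles_subset])
    show "kernel (dC_rel n \<kappa> X A) (dC_rel (n - 1) \<kappa> X A) (dC_rel_boundary n \<kappa> X A)
        = rel_coset n \<kappa> X A ` cycles n \<kappa> X A"
    proof -
      have "dC_rel_boundary n \<kappa> X A (rel_coset n \<kappa> X A c) = \<one>\<^bsub>dC_rel (n - 1) \<kappa> X A\<^esub>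
          \<longleftrightarrow> dQ_boundary n c \<in> chains_on (rel_cubes (n - 1) \<kappa> X A)"
        if "c \<in> chains_on (cubes n \<kappa> X)" for c
        using dC_rel_boundary_coset[OF assms that] C'.one_iff[OF dQ_boundary_cubes[OF that]] by simp
      then show ?thesis unfolding kernel_def C.image_Z[symmetric] cycles_def by blast
    qed
  qed
qed

lemma boundary_image_closed: "add_closed (dQ_boundary n ` chains_on (cubes n \<kappa> X))"
  unfolding add_closed_def
proof (intro conjI ballI)
  show "0 \<in> dQ_boundary n ` chains_on (cubes n \<kappa> X)"
    by (rule image_eqI[of _ _ 0]) auto
  fix x y assume "x \<in> dQ_boundary n ` chains_on (cubes n \<kappa> X)" "y \<in> dQ_boundary n ` chains_on (cubes n \<kappa> X)"
  then obtain a b where "a \<in> chains_on (cubes n \<kappa> X)" "b \<in> chains_on (cubes n \<kappa> X)"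
    "x = dQ_boundary n a" "y = dQ_boundary n b" by blast
  then show "x - y \<in> dQ_boundary n ` chains_on (cubes n \<kappa> X)"
    by (intro image_eqI[of _ _ "a - b"]) (auto simp: dQ_boundary_diff intro: chains_diff)
qed

lemma boundary_image_subset: "dQ_boundary (n + 1) ` chains_on (cubes (n + 1) \<kappa> X) \<subseteq> cycles n \<kappa> X A"
  using dQ_boundary_cubes[of _ "n + 1" \<kappa> X] by (auto simp: cycles_def dQ_boundary_boundary_Suc)

lemma dB_eq:
  assumes "A \<subseteq> X"
  shows "dB n \<kappa> X A = rel_coset n \<kappa> X A ` (dQ_boundary (n + 1) ` chains_on (cubes (n + 1) \<kappa> X))"
  unfolding dB_def presentation.image_Z[OF presentation_dC_rel[OF assms], symmetric] image_image
  using dC_rel_boundary_coset[OF assms, of _ "n + 1" \<kappa>] by auto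

lemma presentation_dH:
  assumes "A \<subseteq> X"
  shows "presentation (dH n \<kappa> X A) (cycles n \<kappa> X A) (boundaries n \<kappa> X A) (hclass n \<kappa> X A)"
  unfolding dH_def hclass_eq[abs_def] dB_eq[OF assms]
  by (rule presentation.quotient[OF presentation_dZ[OF assms] boundary_image_closed boundary_image_subset])
     (auto simp: boundaries_def)

section \<open>Induced maps, the connecting map and homotopy\<close>

lemma dQ_map_diff: "dQ_map n f (a - b) = dQ_map n f a - dQ_map n f b"
  by (simp add: dQ_map_def frag_extend_diff)

lemma dQ_map_add: "dQ_map n f (a + b) = dQ_map n f a + dQ_map n f b"
  by (simp add: dQ_map_def frag_extend_add)

lemma dQ_map_0 [simp]: "dQ_map n f 0 = 0"
  by (simp add: dQ_map_def)

lemma dQ_map_of: "dQ_map n f (frag_of T) = frag_of (push_cube (nat n) f T)"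
  by (simp add: dQ_map_def)

lemma dQ_map_cubes:
  assumes "dig_continuous \<kappa> X \<nu> Y f" "c \<in> chains_on (cubes n \<kappa> X)"
  shows "dQ_map n f c \<in> chains_on (cubes n \<nu> Y)"
  unfolding dQ_map_def
  by (rule frag_extend_chains[OF assms(2)]) (use assms(1) digital_cube_push in \<open>auto simp: cubes_def\<close>)

lemma dQ_map_degenerate:
  assumes "dig_continuous \<kappa> X \<nu> Y f" "c \<in> chains_on (degenerate_cubes n \<kappa> X)"
  shows "dQ_map n f c \<in> chains_on (degenerate_cubes n \<nu> Y)"
  unfolding dQ_map_def
  by (rule frag_extend_chains[OF assms(2)])
     (use assms(1) digital_cube_push degenerate_push in \<open>auto simp: cubes_def degenerate_cubes_def\<close>)

lemma pair_map_sub: "pair_map \<kappa> X A \<nu> Y B f \<Longrightarrow> A \<subseteq> X \<Longrightarrow> dig_continuous \<kappa> A \<nu> B f"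
  unfolding pair_map_def dig_continuous_def by (simp add: image_subset_iff_funcset) blast

lemma pair_map_continuous: "pair_map \<kappa> X A \<nu> Y B f \<Longrightarrow> dig_continuous \<kappa> X \<nu> Y f"
  by (simp add: pair_map_def)

lemma dQ_map_rel:
  assumes "pair_map \<kappa> X A \<nu> Y B f" "A \<subseteq> X" "c \<in> chains_on (rel_cubes n \<kappa> X A)"
  shows "dQ_map n f c \<in> chains_on (rel_cubes n \<nu> Y B)"
proof -
  obtain a b where ab: "a \<in> chains_on (cubes n \<kappa> A)" "b \<in> chains_on (degenerate_cubes n \<kappa> X)" "c = a + b"
    using assms(3) by (rule rel_cubes_memE)
  show ?thesis
    using dQ_map_cubes[OF pair_map_sub[OF assms(1,2)] ab(1)]
      dQ_map_degenerate[OF pair_map_continuous[OF assms(1)] ab(2)] ab(3)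
    by (intro rel_cubes_memI[of "dQ_map n f a"]) (auto simp: dQ_map_add)
qed

lemma dQ_boundary_map: "dQ_boundary n (dQ_map n f c) = dQ_map (n - 1) f (dQ_boundary n c)"
proof -
  have "c \<in> chains_on UNIV" by (simp add: chains_on_def)
  then show ?thesis
  proof (induction rule: chains_induct)
    case (one T)
    have "nat (n - 1) = nat n - 1" by simp
    then show ?case by (simp add: dQ_map_def dQ_boundary_def boundary_push)
  qed (auto simp: dQ_map_diff dQ_boundary_diff)
qed

lemma dQ_map_cycles:
  assumes "pair_map \<kappa> X A \<nu> Y B f" "A \<subseteq> X" "c \<in> cycles n \<kappa> X A"
  shows "dQ_map n f c \<in> cycles n \<nu> Y B"
  using assms dQ_map_cubes[OF pair_map_continuous[OF assms(1)], of c n] dQ_map_rel[OF assms(1,2), of _ "n - 1"]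
  by (simp add: cycles_def dQ_boundary_map)

lemma dQ_map_id:
  assumes "c \<in> chains_on (cubes n \<kappa> X)"
  shows "dQ_map n id c = c"
  using assms
proof (induction rule: chains_induct)
  case (one T)
  then have "push_cube (nat n) id T = T"
    by (simp add: cubes_def digital_cube_iff extensional_restrict)
  then show ?case by (simp only: dQ_map_of)
qed (auto simp: dQ_map_diff)

lemma dQ_map_comp: "dQ_map n (g \<circ> f) c = dQ_map n g (dQ_map n f c)"
proof -
  have "c \<in> chains_on UNIV" by (simp add: chains_on_def)
  then show ?thesis
  proof (induction rule: chains_induct)
    case (one T)
    have "push_cube (nat n) g (push_cube (nat n) f T) = push_cube (nat n) (g \<circ> f) T"
      by (auto intro!: restrict_ext)
    then show ?case by (simp only: dQ_map_of)
  qed (auto simp: dQ_map_diff)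
qed

lemma dC_map_coset:
  assumes "dig_continuous \<kappa> X \<nu> Y f" "c \<in> chains_on (cubes n \<kappa> X)"
  shows "dC_map n \<nu> Y f (abs_coset n \<kappa> X c) = abs_coset n \<nu> Y (dQ_map n f c)"
  unfolding dC_map_def abs_coset_def dD_eq
  by (rule presentation.quot_map_coset[OF presentation_dQ presentation_dQ
        chains_closed chains_mono[OF degenerate_cubes_subset] chains_closed chains_mono[OF degenerate_cubes_subset]])
     (use assms(2) in \<open>auto simp: dQ_map_add intro: dQ_map_cubes[OF assms(1)] dQ_map_degenerate[OF assms(1)]\<close>)

lemma dC_rel_map_coset:
  assumes f: "pair_map \<kappa> X A \<nu> Y B f" and "A \<subseteq> X" "B \<subseteq> Y" "c \<in> chains_on (cubes n \<kappa> X)"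
  shows "dC_rel_map n \<nu> Y B f (rel_coset n \<kappa> X A c) = rel_coset n \<nu> Y B (dQ_map n f c)"
  unfolding dC_rel_map_def rel_coset_def dC_sub_eq[OF assms(2)] dC_sub_eq[OF assms(3)]
  by (rule presentation.quot_map_coset[OF presentation_dC presentation_dC
        chains_closed chains_mono[OF cubes_mono[OF assms(2)]] chains_closed chains_mono[OF cubes_mono[OF assms(3)]]])
     (use assms(4) in \<open>auto simp: dQ_map_add dC_map_coset[OF pair_map_continuous[OF f]]
        intro: dQ_map_cubes[OF pair_map_continuous[OF f]] dQ_map_cubes[OF pair_map_sub[OF f assms(2)]]\<close>)

text \<open>The outermost of three nested applications of \<open>quot_map_coset\<close>. It asks
  that boundaries go to boundaries, which is the chain map property
  \<open>dQ_boundary_map\<close>.\<close>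

lemma dH_map_hclass:
  assumes f: "pair_map \<kappa> X A \<nu> Y B f" and "A \<subseteq> X" "B \<subseteq> Y" "c \<in> cycles n \<kappa> X A"
  shows "dH_map n \<nu> Y B f (hclass n \<kappa> X A c) = hclass n \<nu> Y B (dQ_map n f c)"
  unfolding dH_map_def hclass_eq dB_eq[OF assms(2)] dB_eq[OF assms(3)]
proof (rule presentation.quot_map_coset[OF presentation_dZ[OF assms(2)] presentation_dZ[OF assms(3)]
        boundary_image_closed boundary_image_subset boundary_image_closed boundary_image_subset])
  show "dQ_map n f ` cycles n \<kappa> X A \<subseteq> cycles n \<nu> Y B"
    using dQ_map_cycles[OF f assms(2)] by auto
  show "dQ_map n f ` dQ_boundary (n + 1) ` chains_on (cubes (n + 1) \<kappa> X)
      \<subseteq> dQ_boundary (n + 1) ` chains_on (cubes (n + 1) \<nu> Y)"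
    using dQ_map_cubes[OF pair_map_continuous[OF f], of _ "n + 1"] dQ_boundary_map[of "n + 1" f, symmetric]
    by auto
  show "dC_rel_map n \<nu> Y B f (rel_coset n \<kappa> X A x) = rel_coset n \<nu> Y B (dQ_map n f x)"
    if "x \<in> cycles n \<kappa> X A" for x
    using that cycles_subset[of n \<kappa> X A] by (intro dC_rel_map_coset[OF assms(1-3)]) auto
qed (use assms(4) dQ_map_add in auto)

lemma dH_memE:
  assumes "A \<subseteq> X" "h \<in> carrier (dH n \<kappa> X A)"
  obtains c where "c \<in> cycles n \<kappa> X A" "h = hclass n \<kappa> X A c"
  using presentation.image_Z[OF presentation_dH[OF assms(1), of n \<kappa>]] assms(2) by blast

lemma dH_map_hom:
  assumes "pair_map \<kappa> X A \<nu> Y B f" "A \<subseteq> X" "B \<subseteq> Y"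
  shows "dH_map n \<nu> Y B f \<in> hom (dH n \<kappa> X A) (dH n \<nu> Y B)"
  by (rule presentation.hom_into[OF presentation_dH[OF assms(2)] presentation_dH[OF assms(3)]])
     (use dH_map_hclass[OF assms] dQ_map_cycles[OF assms(1,2)] in \<open>auto simp: dQ_map_add\<close>)

lemma dH_map_id:
  assumes "A \<subseteq> X" "h \<in> carrier (dH n \<kappa> X A)"
  shows "dH_map n \<kappa> X A id h = h"
proof -
  obtain c where c: "c \<in> cycles n \<kappa> X A" "h = hclass n \<kappa> X A c" using assms by (rule dH_memE)
  have "pair_map \<kappa> X A \<kappa> X A id" by (auto simp: pair_map_def dig_continuous_def)
  from dH_map_hclass[OF this assms(1,1) c(1)] show ?thesis
    using c dQ_map_id[of c n \<kappa> X] by (simp add: cycles_def)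
qed

lemma pair_map_comp:
  assumes "pair_map \<kappa> X A \<nu> Y B f" "pair_map \<nu> Y B \<mu> Z C g"
  shows "pair_map \<kappa> X A \<mu> Z C (g \<circ> f)"
proof -
  have "g (f x) = g (f x') \<or> \<mu> (g (f x)) (g (f x'))" if "x \<in> X" "x' \<in> X" "\<kappa> x x'" for x x'
    using assms that unfolding pair_map_def dig_continuous_def by (metis funcset_mem)
  then show ?thesis using assms by (auto simp: pair_map_def dig_continuous_def Pi_iff image_subset_iff)
qed

lemma dH_map_comp:
  assumes "pair_map \<kappa> X A \<nu> Y B f" "pair_map \<nu> Y B \<mu> Z C g" "A \<subseteq> X" "B \<subseteq> Y" "C \<subseteq> Z"
    and "h \<in> carrier (dH n \<kappa> X A)"
  shows "dH_map n \<mu> Z C (g \<circ> f) h = dH_map n \<mu> Z C g (dH_map n \<nu> Y B f h)"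
proof -
  obtain c where c: "c \<in> cycles n \<kappa> X A" "h = hclass n \<kappa> X A c" using assms(3,6) by (rule dH_memE)
  show ?thesis
    using c dH_map_hclass[OF pair_map_comp[OF assms(1,2)] assms(3,5) c(1)]
      dH_map_hclass[OF assms(1,3,4) c(1)] dH_map_hclass[OF assms(2,4,5) dQ_map_cycles[OF assms(1,3) c(1)]]
    by (simp add: dQ_map_comp)
qed

section \<open>Projection of chains onto a set of generators\<close>

definition frag_restrict :: "'b set \<Rightarrow> ('b \<Rightarrow>\<^sub>0 int) \<Rightarrow> ('b \<Rightarrow>\<^sub>0 int)" where
  "frag_restrict S = frag_extend (\<lambda>x. if x \<in> S then frag_of x else 0)"

lemma frag_restrict_simps:
  "frag_restrict S 0 = 0"
  "frag_restrict S (a + b) = frag_restrict S a + frag_restrict S b"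
  "frag_restrict S (a - b) = frag_restrict S a - frag_restrict S b"
  "frag_restrict S (frag_of x) = (if x \<in> S then frag_of x else 0)"
  by (simp_all add: frag_restrict_def frag_extend_diff frag_extend_add)

lemma frag_restrict_chains:
  assumes "c \<in> chains_on T"
  shows "frag_restrict S c \<in> chains_on (S \<inter> T)"
  unfolding frag_restrict_def by (rule frag_extend_chains[OF assms]) auto

lemma frag_restrict_chains_left: "frag_restrict S c \<in> chains_on S"
  using frag_restrict_chains[of c UNIV S] by (simp add: chains_on_def)

lemma frag_restrict_ident:
  assumes "c \<in> chains_on S"
  shows "frag_restrict S c = c"
  using assms by (induction rule: chains_induct) (auto simp: frag_restrict_simps)

lemma frag_restrict_disjoint:
  assumes "c \<in> chains_on T" "S \<inter> T = {}"
  shows "frag_restrict S c = 0"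
  using frag_restrict_chains[OF assms(1), of S] assms(2) by simp

lemma diff_frag_restrict:
  assumes "c \<in> chains_on (S \<union> T)"
  shows "c - frag_restrict S c \<in> chains_on T"
  using assms
proof (induction rule: chains_induct)
  case (diff a b)
  have eq: "a - b - frag_restrict S (a - b) = (a - frag_restrict S a) - (b - frag_restrict S b)"
    by (simp add: frag_restrict_simps)
  show ?case unfolding eq by (rule chains_diff[OF diff(3,4)])
qed (auto simp: frag_restrict_simps)

section \<open>The connecting homomorphism on chains\<close>

lemma rel_cubes_empty [simp]: "rel_cubes n \<kappa> X {} = degenerate_cubes n \<kappa> X"
  by (simp add: rel_cubes_def)

text \<open>Degeneracy of a cube does not refer to the ambient image. In effect
  \<open>dC_incl\<close> is injective, on which the connecting map and exactness depend.\<close>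

lemma degenerate_chains_sub:
  assumes "A \<subseteq> X" "c \<in> chains_on (cubes n \<kappa> A)" "c \<in> chains_on (degenerate_cubes n \<kappa> X)"
  shows "c \<in> chains_on (degenerate_cubes n \<kappa> A)"
  using assms degenerate_cubes_Int[of A X n \<kappa>] chains_Int[of "degenerate_cubes n \<kappa> X" "cubes n \<kappa> A"] by auto

lemma degenerate_chains_mono:
  "A \<subseteq> X \<Longrightarrow> c \<in> chains_on (degenerate_cubes n \<kappa> A) \<Longrightarrow> c \<in> chains_on (degenerate_cubes n \<kappa> X)"
  using chains_mono[OF degenerate_cubes_mono] by blast

lemma cubes_chains_mono:
  "A \<subseteq> X \<Longrightarrow> c \<in> chains_on (cubes n \<kappa> A) \<Longrightarrow> c \<in> chains_on (cubes n \<kappa> X)"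
  using chains_mono[OF cubes_mono] by blast

lemma cubes_chains_rel:
  "c \<in> chains_on (cubes n \<kappa> A) \<Longrightarrow> c \<in> chains_on (rel_cubes n \<kappa> X A)"
  by (rule rel_cubes_memI[of c]) auto

text \<open>As \<partial>\<partial>c = 0, the boundary of a is minus that of the degenerate chain
  \<partial>c - a of X; being a chain of A, it is degenerate in A.\<close>

lemma connecting_cycle:
  assumes "A \<subseteq> X" "c \<in> chains_on (cubes n \<kappa> X)" "a \<in> chains_on (cubes (n - 1) \<kappa> A)"
    "dQ_boundary n c - a \<in> chains_on (degenerate_cubes (n - 1) \<kappa> X)"
  shows "c \<in> cycles n \<kappa> X A" "a \<in> cycles (n - 1) \<kappa> A {}"
proof -
  show "c \<in> cycles n \<kappa> X A"
    using assms rel_cubes_memI[of a "n - 1" \<kappa> A "dQ_boundary n c" X] by (simp add: cycles_def)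
  have "dQ_boundary (n - 1) (dQ_boundary n c - a) \<in> chains_on (degenerate_cubes (n - 1 - 1) \<kappa> X)"
    using assms(4) by (rule dQ_boundary_degenerate)
  then have "dQ_boundary (n - 1) a \<in> chains_on (degenerate_cubes (n - 1 - 1) \<kappa> X)"
    using chains_minus by (fastforce simp: dQ_boundary_diff dQ_boundary_boundary)
  then show "a \<in> cycles (n - 1) \<kappa> A {}"
    using assms(3) degenerate_chains_sub[OF assms(1) dQ_boundary_cubes[OF assms(3)]] by (simp add: cycles_def)
qed

text \<open>Every chain a of A that equals \<partial>c up to degenerate cubes may serve, not just a
  canonical one. Naturality exploits this freedom.\<close>

lemma dH_connecting_hclass:
  assumes AX: "A \<subseteq> X" and c: "c \<in> chains_on (cubes n \<kappa> X)" and a: "a \<in> chains_on (cubes (n - 1) \<kappa> A)"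
    and ca: "dQ_boundary n c - a \<in> chains_on (degenerate_cubes (n - 1) \<kappa> X)"
  shows "dH_connecting n \<kappa> X A (hclass n \<kappa> X A c) = hclass (n - 1) \<kappa> A {} a"
proof -
  interpret C: presentation "dC n \<kappa> X" "chains_on (cubes n \<kappa> X)" "chains_on (degenerate_cubes n \<kappa> X)"
    "abs_coset n \<kappa> X" by (rule presentation_dC)
  interpret C': presentation "dC (n - 1) \<kappa> X" "chains_on (cubes (n - 1) \<kappa> X)"
    "chains_on (degenerate_cubes (n - 1) \<kappa> X)" "abs_coset (n - 1) \<kappa> X" by (rule presentation_dC)
  interpret CA: presentation "dC (n - 1) \<kappa> A" "chains_on (cubes (n - 1) \<kappa> A)"
    "chains_on (degenerate_cubes (n - 1) \<kappa> A)" "abs_coset (n - 1) \<kappa> A" by (rule presentation_dC)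
  interpret H: presentation "dH n \<kappa> X A" "cycles n \<kappa> X A" "boundaries n \<kappa> X A" "hclass n \<kappa> X A"
    by (rule presentation_dH[OF AX])
  interpret HA: presentation "dH (n - 1) \<kappa> A {}" "cycles (n - 1) \<kappa> A {}" "boundaries (n - 1) \<kappa> A {}"
    "hclass (n - 1) \<kappa> A {}" by (rule presentation_dH) simp
  have iff: "dC_incl (n - 1) \<kappa> X (abs_coset (n - 1) \<kappa> A a') = dC_boundary n \<kappa> X (abs_coset n \<kappa> X c')
      \<longleftrightarrow> dQ_boundary n c' - a' \<in> chains_on (degenerate_cubes (n - 1) \<kappa> X)"
    if "c' \<in> chains_on (cubes n \<kappa> X)" "a' \<in> chains_on (cubes (n - 1) \<kappa> A)" for c' a'
    using that C'.eq_iff[OF dQ_boundary_cubes[OF that(1)] cubes_chains_mono[OF AX that(2)]]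
    by (auto simp: dC_incl_coset[OF AX] dC_boundary_coset)
  show ?thesis
    unfolding dH_connecting_def
  proof (rule the_equality)
    show "\<exists>u\<in>carrier (dC n \<kappa> X). \<exists>v\<in>carrier (dC (n - 1) \<kappa> A).
        hclass n \<kappa> X A c = dH_class n \<kappa> X A u \<and> dC_incl (n - 1) \<kappa> X v = dC_boundary n \<kappa> X u
        \<and> hclass (n - 1) \<kappa> A {} a = dH_class (n - 1) \<kappa> A {} v"
      using C.closed[OF c] CA.closed[OF a] iff[OF c a] ca by (auto simp: hclass_def)
  next
    fix k
    assume "\<exists>u\<in>carrier (dC n \<kappa> X). \<exists>v\<in>carrier (dC (n - 1) \<kappa> A).
        hclass n \<kappa> X A c = dH_class n \<kappa> X A u \<and> dC_incl (n - 1) \<kappa> X v = dC_boundary n \<kappa> X u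
        \<and> k = dH_class (n - 1) \<kappa> A {} v"
    then obtain c' a' where c': "c' \<in> chains_on (cubes n \<kappa> X)" and a': "a' \<in> chains_on (cubes (n - 1) \<kappa> A)"
      and eq: "hclass n \<kappa> X A c = hclass n \<kappa> X A c'" and k: "k = hclass (n - 1) \<kappa> A {} a'"
      and "dC_incl (n - 1) \<kappa> X (abs_coset (n - 1) \<kappa> A a') = dC_boundary n \<kappa> X (abs_coset n \<kappa> X c')"
      unfolding C.image_Z[symmetric] CA.image_Z[symmetric] by (auto simp: hclass_def)
    then have ca': "dQ_boundary n c' - a' \<in> chains_on (degenerate_cubes (n - 1) \<kappa> X)"
      using iff by blast
    have "c - c' \<in> boundaries n \<kappa> X A"
      using eq H.eq_iff connecting_cycle(1)[OF AX c a ca] connecting_cycle(1)[OF AX c' a' ca'] by blast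
    then obtain b where "c - c' - dQ_boundary (n + 1) b \<in> chains_on (rel_cubes n \<kappa> X A)"
      by (auto simp: boundaries_def)
    then obtain r e where r: "r \<in> chains_on (cubes n \<kappa> A)" and e: "e \<in> chains_on (degenerate_cubes n \<kappa> X)"
      and re: "c - c' - dQ_boundary (n + 1) b = r + e" by (rule rel_cubes_memE)
    from re have "c = c' + dQ_boundary (n + 1) b + r + e" by (simp add: algebra_simps)
    \<comment> \<open>The boundary of b drops out, so a and a' differ by the boundary of the chain r
      of A, up to degenerate cubes.\<close>
    then have "dQ_boundary n c = dQ_boundary n c' + dQ_boundary n r + dQ_boundary n e"
      by (simp add: dQ_boundary_add dQ_boundary_boundary_Suc)
    then have "a - a' - dQ_boundary n r
        = (dQ_boundary n c' - a') - (dQ_boundary n c - a) + dQ_boundary n e"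
      by (simp add: algebra_simps)
    also have "\<dots> \<in> chains_on (degenerate_cubes (n - 1) \<kappa> X)"
      by (rule chains_add[OF chains_diff[OF ca' ca] dQ_boundary_degenerate[OF e]])
    finally have "a - a' - dQ_boundary n r \<in> chains_on (degenerate_cubes (n - 1) \<kappa> A)"
      by (rule degenerate_chains_sub[OF AX chains_diff[OF chains_diff[OF a a'] dQ_boundary_cubes[OF r]]])
    then have "a - a' \<in> boundaries (n - 1) \<kappa> A {}"
      using r by (auto simp: boundaries_def)
    then show "k = hclass (n - 1) \<kappa> A {} a"
      using HA.eq_iff connecting_cycle(2)[OF AX c a ca] connecting_cycle(2)[OF AX c' a' ca'] k by metis
  qed
qed

text \<open>An additive choice of the chain in A, as \<open>hom_into\<close> requires. It keeps all
  cubes of \<partial>c that lie in A, the degenerate ones included.\<close>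

definition sub_boundary :: "int \<Rightarrow> ('a \<Rightarrow> 'a \<Rightarrow> bool) \<Rightarrow> 'a set \<Rightarrow> 'a cube_chain \<Rightarrow> 'a cube_chain" where
  "sub_boundary n \<kappa> A c = frag_restrict (cubes (n - 1) \<kappa> A) (dQ_boundary n c)"

lemma sub_boundary:
  assumes "c \<in> cycles n \<kappa> X A"
  shows "c \<in> chains_on (cubes n \<kappa> X)" "sub_boundary n \<kappa> A c \<in> chains_on (cubes (n - 1) \<kappa> A)"
    "dQ_boundary n c - sub_boundary n \<kappa> A c \<in> chains_on (degenerate_cubes (n - 1) \<kappa> X)"
  using assms diff_frag_restrict[of "dQ_boundary n c" "cubes (n - 1) \<kappa> A" "degenerate_cubes (n - 1) \<kappa> X"]
  by (auto simp: cycles_def sub_boundary_def frag_restrict_chains_left rel_cubes_def)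

lemma dH_connecting_sub_boundary:
  assumes "A \<subseteq> X" "c \<in> cycles n \<kappa> X A"
  shows "dH_connecting n \<kappa> X A (hclass n \<kappa> X A c) = hclass (n - 1) \<kappa> A {} (sub_boundary n \<kappa> A c)"
  using dH_connecting_hclass[OF assms(1) sub_boundary[OF assms(2)]] .

lemma sub_boundary_cycles:
  assumes "A \<subseteq> X" "c \<in> cycles n \<kappa> X A"
  shows "sub_boundary n \<kappa> A c \<in> cycles (n - 1) \<kappa> A {}"
  using connecting_cycle(2)[OF assms(1) sub_boundary[OF assms(2)]] .

lemma dH_connecting_hom:
  assumes "A \<subseteq> X"
  shows "dH_connecting n \<kappa> X A \<in> hom (dH n \<kappa> X A) (dH (n - 1) \<kappa> A {})"
  by (rule presentation.hom_into[OF presentation_dH[OF assms] presentation_dH])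
     (use sub_boundary_cycles[OF assms] dH_connecting_sub_boundary[OF assms]
       in \<open>auto simp: sub_boundary_def dQ_boundary_add frag_restrict_simps\<close>)

text \<open>\<open>sub_boundary\<close> need not commute with f, because f can carry a degenerate
  cube outside A into B. The image of \<open>sub_boundary\<close> is nevertheless admissible in
  \<open>dH_connecting_hclass\<close>.\<close>

lemma dH_connecting_natural:
  assumes f: "pair_map \<kappa> X A \<nu> Y B f" and AX: "A \<subseteq> X" and BY: "B \<subseteq> Y"
    and h: "h \<in> carrier (dH n \<kappa> X A)"
  shows "dH_map (n - 1) \<nu> B {} f (dH_connecting n \<kappa> X A h) = dH_connecting n \<nu> Y B (dH_map n \<nu> Y B f h)"
proof -
  obtain c where c: "c \<in> cycles n \<kappa> X A" "h = hclass n \<kappa> X A c" using AX h by (rule dH_memE)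
  let ?a = "sub_boundary n \<kappa> A c"
  have fA: "pair_map \<kappa> A {} \<nu> B {} f" using pair_map_sub[OF f AX] by (simp add: pair_map_def)
  have "dQ_map (n - 1) f (dQ_boundary n c - ?a) \<in> chains_on (degenerate_cubes (n - 1) \<nu> Y)"
    using dQ_map_degenerate[OF pair_map_continuous[OF f] sub_boundary(3)[OF c(1)]] .
  then have "dH_connecting n \<nu> Y B (hclass n \<nu> Y B (dQ_map n f c)) = hclass (n - 1) \<nu> B {} (dQ_map (n - 1) f ?a)"
    using dQ_map_cubes[OF pair_map_continuous[OF f] sub_boundary(1)[OF c(1)]]
      dQ_map_cubes[OF pair_map_sub[OF f AX] sub_boundary(2)[OF c(1)]]
    by (intro dH_connecting_hclass[OF BY]) (simp_all add: dQ_boundary_map dQ_map_diff)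
  then show ?thesis
    using c dH_map_hclass[OF f AX BY c(1)] dH_connecting_sub_boundary[OF AX c(1)]
      dH_map_hclass[OF fA _ _ sub_boundary_cycles[OF AX c(1)]] by simp
qed

section \<open>Homotopy invariance\<close>

definition dQ_prism :: "int \<Rightarrow> ('a \<Rightarrow> 'b) \<Rightarrow> ('a \<Rightarrow> 'b) \<Rightarrow> 'a cube_chain \<Rightarrow> 'b cube_chain" where
  "dQ_prism n f g = frag_extend (\<lambda>T. frag_of (prism (nat n) f g T))"

text \<open>The bound on n makes \<open>nat (n + 1)\<close> the successor of \<open>nat n\<close>.
  For n = 0 the last term vanishes, as the boundary is zero in degree 0.\<close>

lemma dQ_boundary_prism:
  assumes "0 \<le> n"
  shows "dQ_boundary (n + 1) (dQ_prism n f g c)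
    = dQ_map n g c - dQ_map n f c - dQ_prism (n - 1) f g (dQ_boundary n c)"
proof -
  have n: "nat (n + 1) = Suc (nat n)" "nat (n - 1) = nat n - 1" using assms by auto
  have "c \<in> chains_on UNIV" by (simp add: chains_on_def)
  then show ?thesis
  proof (induction rule: chains_induct)
    case (one T)
    show ?case by (simp add: dQ_prism_def dQ_boundary_def dQ_map_def n boundary_prism)
  next
    case (diff a b)
    then show ?case by (simp add: dQ_prism_def dQ_boundary_diff dQ_map_diff frag_extend_diff)
  qed (auto simp: dQ_prism_def)
qed

lemma dQ_prism_cubes:
  assumes f: "dig_continuous \<kappa> X \<nu> Y f" and g: "dig_continuous \<kappa> X \<nu> Y g"
    and fg: "\<And>x. x \<in> X \<Longrightarrow> f x = g x \<or> \<nu> (f x) (g x) \<and> \<nu> (g x) (f x)"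
  shows "c \<in> chains_on (cubes n \<kappa> X) \<Longrightarrow> dQ_prism n f g c \<in> chains_on (cubes (n + 1) \<nu> Y)"
    "c \<in> chains_on (degenerate_cubes n \<kappa> X) \<Longrightarrow> dQ_prism n f g c \<in> chains_on (degenerate_cubes (n + 1) \<nu> Y)"
proof -
  have n: "nat (n + 1) = Suc (nat n)" if "0 \<le> n" using that by auto
  have "frag_of (prism (nat n) f g T) \<in> chains_on (cubes (n + 1) \<nu> Y)" if "T \<in> cubes n \<kappa> X" for T
    using that digital_cube_prism[OF f g fg, where T = T and n = "nat n"] n by (auto simp: cubes_def)
  moreover have "frag_of (prism (nat n) f g T) \<in> chains_on (degenerate_cubes (n + 1) \<nu> Y)"
    if "T \<in> degenerate_cubes n \<kappa> X" for T
    using that digital_cube_prism[OF f g fg, where T = T and n = "nat n"] n degenerate_prism[of "nat n" T f g]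
    by (auto simp: cubes_def degenerate_cubes_def)
  ultimately show
    "c \<in> chains_on (cubes n \<kappa> X) \<Longrightarrow> dQ_prism n f g c \<in> chains_on (cubes (n + 1) \<nu> Y)"
    "c \<in> chains_on (degenerate_cubes n \<kappa> X) \<Longrightarrow> dQ_prism n f g c \<in> chains_on (degenerate_cubes (n + 1) \<nu> Y)"
    unfolding dQ_prism_def by (auto elim!: frag_extend_chains)
qed

text \<open>The prism over \<partial>c is null: over the part in A it lies in B, since f and g both
  map A into B, and over the degenerate part it is degenerate. So the prism over c bounds the
  difference of the two images.\<close>

lemma dH_map_step:
  assumes f: "pair_map \<kappa> X A \<nu> Y B f" and g: "pair_map \<kappa> X A \<nu> Y B g"
    and AX: "A \<subseteq> X" and BY: "B \<subseteq> Y"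
    and fg: "\<And>x. x \<in> X \<Longrightarrow> f x = g x \<or> \<nu> (f x) (g x) \<and> \<nu> (g x) (f x)"
    and h: "h \<in> carrier (dH n \<kappa> X A)"
  shows "dH_map n \<nu> Y B f h = dH_map n \<nu> Y B g h"
proof -
  obtain c where c: "c \<in> cycles n \<kappa> X A" "h = hclass n \<kappa> X A c" using AX h by (rule dH_memE)
  interpret H: presentation "dH n \<nu> Y B" "cycles n \<nu> Y B" "boundaries n \<nu> Y B" "hclass n \<nu> Y B"
    by (rule presentation_dH[OF BY])
  have "dQ_map n g c - dQ_map n f c \<in> boundaries n \<nu> Y B"
  proof (cases "0 \<le> n")
    case True
    have "dQ_boundary n c \<in> chains_on (rel_cubes (n - 1) \<kappa> X A)" using c(1) by (simp add: cycles_def)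
    then obtain a e where a: "a \<in> chains_on (cubes (n - 1) \<kappa> A)"
      and e: "e \<in> chains_on (degenerate_cubes (n - 1) \<kappa> X)" and ae: "dQ_boundary n c = a + e"
      by (rule rel_cubes_memE)
    have "dQ_prism (n - 1) f g a \<in> chains_on (cubes n \<nu> B)"
      using dQ_prism_cubes(1)[OF pair_map_sub[OF f AX] pair_map_sub[OF g AX] _ a] fg AX by auto
    moreover have "dQ_prism (n - 1) f g e \<in> chains_on (degenerate_cubes n \<nu> Y)"
      using dQ_prism_cubes(2)[OF pair_map_continuous[OF f] pair_map_continuous[OF g] fg e] by simp
    ultimately have "dQ_prism (n - 1) f g (dQ_boundary n c) \<in> chains_on (rel_cubes n \<nu> Y B)"
      by (intro rel_cubes_memI[of "dQ_prism (n - 1) f g a"])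
         (auto simp: ae dQ_prism_def frag_extend_add)
    moreover have "dQ_prism n f g c \<in> chains_on (cubes (n + 1) \<nu> Y)"
      using dQ_prism_cubes(1)[OF pair_map_continuous[OF f] pair_map_continuous[OF g] fg] c(1)
      by (simp add: cycles_def)
    ultimately show ?thesis
      unfolding boundaries_def using dQ_boundary_prism[OF True, of f g c]
      by (intro CollectI bexI[of _ "dQ_prism n f g c"]) simp_all
  next
    case False
    then have "c = 0" using c(1) by (simp add: cycles_def)
    then show ?thesis by (auto simp: boundaries_def intro!: bexI[of _ 0])
  qed
  then have "hclass n \<nu> Y B (dQ_map n g c) = hclass n \<nu> Y B (dQ_map n f c)"
    using H.eq_iff dQ_map_cycles[OF f AX c(1)] dQ_map_cycles[OF g AX c(1)] by simp
  then show ?thesis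
    using dH_map_hclass[OF f AX BY c(1)] dH_map_hclass[OF g AX BY c(1)] c(2) by simp
qed

lemma int_adj_Suc: "int_adj t (t + 1)"
proof -
  have "card {i. i < Suc 0 \<and> [t] ! i \<noteq> [t + 1] ! i} \<le> card {0::nat}"
    by (rule card_mono) auto
  then show ?thesis by (simp add: int_adj_def c_adj_def)
qed

text \<open>Consecutive stages \<open>H k\<close> and \<open>H (k + 1)\<close> move each point to an
  equal or adjacent one, so the homotopy is a succession of single steps.\<close>

lemma dH_map_homotopic:
  assumes f: "pair_map \<kappa> X A \<nu> Y B f" and g: "pair_map \<kappa> X A \<nu> Y B g"
    and AX: "A \<subseteq> X" and BY: "B \<subseteq> Y" and sym: "\<And>x y. \<nu> x y \<Longrightarrow> \<nu> y x"
    and fg: "pair_homotopic \<kappa> X A \<nu> Y B f g" and h: "h \<in> carrier (dH n \<kappa> X A)"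
  shows "dH_map n \<nu> Y B f h = dH_map n \<nu> Y B g h"
proof -
  obtain m H where m: "m > 0" and H0: "\<And>x. x \<in> X \<Longrightarrow> H 0 x = f x" and Hm: "\<And>x. x \<in> X \<Longrightarrow> H m x = g x"
    and Hx: "\<And>x. x \<in> X \<Longrightarrow> dig_continuous int_adj {0..m} \<nu> Y (\<lambda>t. H t x)"
    and Ht: "\<And>t. t \<in> {0..m} \<Longrightarrow> pair_map \<kappa> X A \<nu> Y B (H t)"
    using fg unfolding pair_homotopic_def pair_map_def by metis
  have "dH_map n \<nu> Y B (H 0) h = dH_map n \<nu> Y B (H (int k)) h" if "int k \<le> m" for k
    using that
  proof (induction k)
    case (Suc k)
    have adj: "H (int k) x = H (int (Suc k)) x \<or> \<nu> (H (int k) x) (H (int (Suc k)) x)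
        \<and> \<nu> (H (int (Suc k)) x) (H (int k) x)" if "x \<in> X" for x
    proof -
      have "int k \<in> {0..m}" "int (Suc k) \<in> {0..m}" "int_adj (int k) (int (Suc k))"
        using Suc.prems int_adj_Suc[of "int k"] by (auto simp: add.commute)
      then have "H (int k) x = H (int (Suc k)) x \<or> \<nu> (H (int k) x) (H (int (Suc k)) x)"
        using Hx[OF that] unfolding dig_continuous_def by blast
      then show ?thesis using sym by blast
    qed
    have "dH_map n \<nu> Y B (H (int k)) h = dH_map n \<nu> Y B (H (int (Suc k))) h"
      using Suc.prems by (intro dH_map_step[OF Ht Ht AX BY adj h]) auto
    then show ?case using Suc by simp
  qed simp
  from this[of "nat m"] have "dH_map n \<nu> Y B (H 0) h = dH_map n \<nu> Y B (H m) h" using m by simp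
  \<comment> \<open>The maps f and \<open>H 0\<close> agree only on X. They are compared by one more
    step, in which no point of X moves; likewise for \<open>H m\<close> and g.\<close>
  moreover have "dH_map n \<nu> Y B f h = dH_map n \<nu> Y B (H 0) h"
    using m H0 by (intro dH_map_step[OF f Ht AX BY _ h]) auto
  moreover have "dH_map n \<nu> Y B (H m) h = dH_map n \<nu> Y B g h"
    using m Hm by (intro dH_map_step[OF Ht g AX BY _ h]) auto
  ultimately show ?thesis by simp
qed

section \<open>Exactness and excision\<close>

text \<open>Exactness at G becomes a statement on representatives: g sends z to a null chain iff z
  agrees modulo K with some f w. The next three lemmas have the form of its last premise.\<close>

lemma kernel_eq_image:
  assumes F: "presentation F Z\<^sub>0 K\<^sub>0 \<phi>\<^sub>0" and G: "presentation G Z K \<phi>" and H: "presentation H Z' K' \<phi>'"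
    and f: "\<And>z. z \<in> Z\<^sub>0 \<Longrightarrow> f z \<in> Z \<and> \<psi> (\<phi>\<^sub>0 z) = \<phi> (f z)"
    and g: "\<And>z. z \<in> Z \<Longrightarrow> g z \<in> Z' \<and> \<theta> (\<phi> z) = \<phi>' (g z)"
    and exact: "\<And>z. z \<in> Z \<Longrightarrow> g z \<in> K' \<longleftrightarrow> (\<exists>w\<in>Z\<^sub>0. z - f w \<in> K)"
  shows "kernel G H \<theta> = \<psi> ` carrier F"
proof -
  interpret F: presentation F Z\<^sub>0 K\<^sub>0 \<phi>\<^sub>0 by (rule F)
  interpret G: presentation G Z K \<phi> by (rule G)
  interpret H: presentation H Z' K' \<phi>' by (rule H)
  have iff: "\<theta> (\<phi> z) = \<one>\<^bsub>H\<^esub> \<longleftrightarrow> \<phi> z \<in> \<psi> ` carrier F" if z: "z \<in> Z" for z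
  proof -
    have "\<theta> (\<phi> z) = \<one>\<^bsub>H\<^esub> \<longleftrightarrow> g z \<in> K'" using g[OF z] H.one_iff by simp
    also have "\<dots> \<longleftrightarrow> (\<exists>w\<in>Z\<^sub>0. z - f w \<in> K)" by (rule exact[OF z])
    also have "\<dots> \<longleftrightarrow> (\<exists>w\<in>Z\<^sub>0. \<phi> z = \<psi> (\<phi>\<^sub>0 w))"
      by (intro bex_cong refl) (use f G.eq_iff[OF z] in simp)
    also have "\<dots> \<longleftrightarrow> \<phi> z \<in> \<psi> ` carrier F"
      unfolding F.image_Z[symmetric] image_image by (auto simp: image_iff)
    finally show ?thesis .
  qed
  then have "\<theta> x = \<one>\<^bsub>H\<^esub> \<longleftrightarrow> x \<in> \<psi> ` carrier F" if "x \<in> carrier G" for x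
    using that unfolding G.image_Z[symmetric] by (elim imageE) (simp only: iff)
  moreover have "\<psi> ` carrier F \<subseteq> carrier G"
    unfolding F.image_Z[symmetric] using f G.closed by auto
  ultimately show ?thesis
    unfolding kernel_def by (simp add: set_eq_iff subset_iff) metis
qed

text \<open>If z - \<partial>b is a chain a of A plus a degenerate chain, then a itself is the
  required cycle of A.\<close>

lemma exact_at_absolute:
  assumes AX: "A \<subseteq> X" and z: "z \<in> cycles n \<kappa> X {}"
  shows "z \<in> boundaries n \<kappa> X A \<longleftrightarrow> (\<exists>w\<in>cycles n \<kappa> A {}. z - w \<in> boundaries n \<kappa> X {})"
proof
  assume "z \<in> boundaries n \<kappa> X A"
  then obtain b where b: "b \<in> chains_on (cubes (n + 1) \<kappa> X)"
    and "z - dQ_boundary (n + 1) b \<in> chains_on (rel_cubes n \<kappa> X A)" by (auto simp: boundaries_def)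
  then obtain a e where a: "a \<in> chains_on (cubes n \<kappa> A)" and e: "e \<in> chains_on (degenerate_cubes n \<kappa> X)"
    and ae: "z - dQ_boundary (n + 1) b = a + e" using rel_cubes_memE by blast
  have "z = a + e + dQ_boundary (n + 1) b" using ae by (simp add: algebra_simps)
  then have "dQ_boundary n a = dQ_boundary n z - dQ_boundary n e"
    by (simp add: dQ_boundary_add dQ_boundary_boundary_Suc)
  also have "\<dots> \<in> chains_on (degenerate_cubes (n - 1) \<kappa> X)"
    using z dQ_boundary_degenerate[OF e] by (intro chains_diff) (auto simp: cycles_def)
  finally have "a \<in> cycles n \<kappa> A {}"
    using a degenerate_chains_sub[OF AX dQ_boundary_cubes[OF a]] by (simp add: cycles_def)
  moreover have "z - a - dQ_boundary (n + 1) b = e" using ae by (simp add: algebra_simps)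
  then have "z - a \<in> boundaries n \<kappa> X {}" using b e by (auto simp: boundaries_def)
  ultimately show "\<exists>w\<in>cycles n \<kappa> A {}. z - w \<in> boundaries n \<kappa> X {}" by blast
next
  assume "\<exists>w\<in>cycles n \<kappa> A {}. z - w \<in> boundaries n \<kappa> X {}"
  then obtain w b where w: "w \<in> cycles n \<kappa> A {}" and b: "b \<in> chains_on (cubes (n + 1) \<kappa> X)"
    and e: "z - w - dQ_boundary (n + 1) b \<in> chains_on (degenerate_cubes n \<kappa> X)"
    by (auto simp: boundaries_def)
  have "z - dQ_boundary (n + 1) b - w \<in> chains_on (degenerate_cubes n \<kappa> X)"
    using e by (simp add: algebra_simps)
  then have "z - dQ_boundary (n + 1) b \<in> chains_on (rel_cubes n \<kappa> X A)"
    using w by (intro rel_cubes_memI[of w]) (auto simp: cycles_def)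
  then show "z \<in> boundaries n \<kappa> X A" using b by (auto simp: boundaries_def)
qed

text \<open>If b fills the boundary of z inside A, then z - b is an absolute cycle, and the
  discrepancy b is null relative to A.\<close>

lemma exact_at_relative:
  assumes AX: "A \<subseteq> X" and z: "z \<in> cycles n \<kappa> X A"
  shows "sub_boundary n \<kappa> A z \<in> boundaries (n - 1) \<kappa> A {}
    \<longleftrightarrow> (\<exists>w\<in>cycles n \<kappa> X {}. z - w \<in> boundaries n \<kappa> X A)" (is "?a \<in> _ \<longleftrightarrow> ?rhs")
proof
  assume "?a \<in> boundaries (n - 1) \<kappa> A {}"
  then obtain b where b: "b \<in> chains_on (cubes n \<kappa> A)"
    and e: "?a - dQ_boundary n b \<in> chains_on (degenerate_cubes (n - 1) \<kappa> A)"
    by (auto simp: boundaries_def)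
  have "dQ_boundary n (z - b) = (dQ_boundary n z - ?a) + (?a - dQ_boundary n b)"
    by (simp add: dQ_boundary_diff)
  also have "\<dots> \<in> chains_on (degenerate_cubes (n - 1) \<kappa> X)"
    by (rule chains_add[OF sub_boundary(3)[OF z] degenerate_chains_mono[OF AX e]])
  finally have "z - b \<in> cycles n \<kappa> X {}"
    using chains_diff[OF sub_boundary(1)[OF z] cubes_chains_mono[OF AX b]] by (simp add: cycles_def)
  moreover have "z - (z - b) \<in> boundaries n \<kappa> X A"
    using cubes_chains_rel[OF b] by (auto simp: boundaries_def intro!: bexI[of _ 0])
  ultimately show ?rhs by blast
next
  assume ?rhs
  then obtain w b where w: "w \<in> cycles n \<kappa> X {}"
    and "z - w - dQ_boundary (n + 1) b \<in> chains_on (rel_cubes n \<kappa> X A)"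
    by (auto simp: boundaries_def)
  then obtain r e where r: "r \<in> chains_on (cubes n \<kappa> A)" and e: "e \<in> chains_on (degenerate_cubes n \<kappa> X)"
    and re: "z - w - dQ_boundary (n + 1) b = r + e" using rel_cubes_memE by blast
  have "z = w + dQ_boundary (n + 1) b + r + e" using re by (simp add: algebra_simps)
  then have "dQ_boundary n z = dQ_boundary n w + dQ_boundary n r + dQ_boundary n e"
    by (simp add: dQ_boundary_add dQ_boundary_boundary_Suc)
  then have "?a - dQ_boundary n r = dQ_boundary n w + dQ_boundary n e - (dQ_boundary n z - ?a)"
    by (simp add: algebra_simps)
  also have "\<dots> \<in> chains_on (degenerate_cubes (n - 1) \<kappa> X)"
    by (rule chains_diff[OF chains_add[OF _ dQ_boundary_degenerate[OF e]] sub_boundary(3)[OF z]])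
       (use w in \<open>simp add: cycles_def\<close>)
  finally have "?a - dQ_boundary n r \<in> chains_on (degenerate_cubes (n - 1) \<kappa> A)"
    by (rule degenerate_chains_sub[OF AX chains_diff[OF sub_boundary(2)[OF z] dQ_boundary_cubes[OF r]]])
  then show "?a \<in> boundaries (n - 1) \<kappa> A {}" using r by (auto simp: boundaries_def)
qed

text \<open>A filling b of z in X is a relative cycle whose boundary in A is z up to degenerate
  cubes. Conversely, w together with a filling in A of the remaining difference fills z in
  X.\<close>

lemma exact_at_subspace:
  assumes AX: "A \<subseteq> X" and z: "z \<in> cycles (n - 1) \<kappa> A {}"
  shows "z \<in> boundaries (n - 1) \<kappa> X {}
    \<longleftrightarrow> (\<exists>w\<in>cycles n \<kappa> X A. z - sub_boundary n \<kappa> A w \<in> boundaries (n - 1) \<kappa> A {})"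
proof
  assume "z \<in> boundaries (n - 1) \<kappa> X {}"
  then obtain b where b: "b \<in> chains_on (cubes n \<kappa> X)"
    and e: "z - dQ_boundary n b \<in> chains_on (degenerate_cubes (n - 1) \<kappa> X)"
    by (auto simp: boundaries_def)
  have zA: "z \<in> chains_on (cubes (n - 1) \<kappa> A)" using z by (simp add: cycles_def)
  have e': "dQ_boundary n b - z \<in> chains_on (degenerate_cubes (n - 1) \<kappa> X)"
    using chains_minus[OF e] by simp
  have bc: "b \<in> cycles n \<kappa> X A" by (rule connecting_cycle(1)[OF AX b zA e'])
  let ?a = "sub_boundary n \<kappa> A b"
  have "z - ?a = (z - dQ_boundary n b) + (dQ_boundary n b - ?a)" by simp
  also have "\<dots> \<in> chains_on (degenerate_cubes (n - 1) \<kappa> X)"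
    by (rule chains_add[OF e sub_boundary(3)[OF bc]])
  finally have "z - ?a \<in> chains_on (degenerate_cubes (n - 1) \<kappa> A)"
    by (rule degenerate_chains_sub[OF AX chains_diff[OF zA sub_boundary(2)[OF bc]]])
  then have "z - ?a \<in> boundaries (n - 1) \<kappa> A {}"
    by (auto simp: boundaries_def intro!: bexI[of _ 0])
  then show "\<exists>w\<in>cycles n \<kappa> X A. z - sub_boundary n \<kappa> A w \<in> boundaries (n - 1) \<kappa> A {}" using bc by blast
next
  assume "\<exists>w\<in>cycles n \<kappa> X A. z - sub_boundary n \<kappa> A w \<in> boundaries (n - 1) \<kappa> A {}"
  then obtain w b where w: "w \<in> cycles n \<kappa> X A" and b: "b \<in> chains_on (cubes n \<kappa> A)"
    and e: "z - sub_boundary n \<kappa> A w - dQ_boundary n b \<in> chains_on (degenerate_cubes (n - 1) \<kappa> A)"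
    by (auto simp: boundaries_def)
  let ?a = "sub_boundary n \<kappa> A w"
  have "z - dQ_boundary n (w + b) = (z - ?a - dQ_boundary n b) - (dQ_boundary n w - ?a)"
    by (simp add: dQ_boundary_add algebra_simps)
  also have "\<dots> \<in> chains_on (degenerate_cubes (n - 1) \<kappa> X)"
    by (rule chains_diff[OF degenerate_chains_mono[OF AX e] sub_boundary(3)[OF w]])
  finally show "z \<in> boundaries (n - 1) \<kappa> X {}"
    using chains_add[OF sub_boundary(1)[OF w] cubes_chains_mono[OF AX b]]
    by (auto simp: boundaries_def intro!: bexI[of _ "w + b"])
qed

lemma pair_map_id: "A \<subseteq> B \<Longrightarrow> X \<subseteq> Y \<Longrightarrow> pair_map \<kappa> X A \<kappa> Y B id"
  by (auto simp: pair_map_def dig_continuous_def)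

lemma dH_map_id_hclass:
  assumes "A \<subseteq> B" "X \<subseteq> Y" "A \<subseteq> X" "B \<subseteq> Y" "c \<in> cycles n \<kappa> X A"
  shows "c \<in> cycles n \<kappa> Y B" "dH_map n \<kappa> Y B id (hclass n \<kappa> X A c) = hclass n \<kappa> Y B c"
proof -
  have "dQ_map n id c = c" using assms(5) dQ_map_id[of c n \<kappa> X] by (simp add: cycles_def)
  then show "c \<in> cycles n \<kappa> Y B" "dH_map n \<kappa> Y B id (hclass n \<kappa> X A c) = hclass n \<kappa> Y B c"
    using dQ_map_cycles[OF pair_map_id[OF assms(1,2)] assms(3,5)]
      dH_map_hclass[OF pair_map_id[OF assms(1,2)] assms(3,4,5)] by simp_all
qed

lemma dH_comm_group: "A \<subseteq> X \<Longrightarrow> comm_group (dH n \<kappa> X A)"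
  using presentation_dH[of A X n \<kappa>] by (simp add: presentation_def)

text \<open>The windows for n and n - 1 overlap in the map from
  \<open>dH (n - 1) \<kappa> A {}\<close> to \<open>dH (n - 1) \<kappa> X {}\<close>, so letting n
  vary gives the whole long sequence.\<close>

lemma dH_exact:
  assumes AX: "A \<subseteq> X"
  shows "exact_seq
    ([dH (n - 1) \<kappa> X {}, dH (n - 1) \<kappa> A {}, dH n \<kappa> X A, dH n \<kappa> X {}, dH n \<kappa> A {}],
     [dH_map (n - 1) \<kappa> X {} id, dH_connecting n \<kappa> X A, dH_map n \<kappa> X A id, dH_map n \<kappa> X {} id])"
proof -
  have grp: "group (dH k \<kappa> Y B)" if "B \<subseteq> Y" for k Y B
    using dH_comm_group[OF that] by (simp add: comm_group_def)
  have i: "dH_map k \<kappa> X {} id \<in> hom (dH k \<kappa> A {}) (dH k \<kappa> X {})" for k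
    by (rule dH_map_hom[OF pair_map_id]) (use AX in auto)
  have j: "dH_map n \<kappa> X A id \<in> hom (dH n \<kappa> X {}) (dH n \<kappa> X A)"
    by (rule dH_map_hom[OF pair_map_id]) (use AX in auto)
  note d = dH_connecting_hom[OF AX, of n \<kappa>]
  have i_class: "z \<in> cycles k \<kappa> X {} \<and> dH_map k \<kappa> X {} id (hclass k \<kappa> A {} z) = hclass k \<kappa> X {} z"
    if "z \<in> cycles k \<kappa> A {}" for k z
    using dH_map_id_hclass[of "{}" "{}" A X, OF _ AX _ _ that] by simp
  have j_class: "z \<in> cycles n \<kappa> X A \<and> dH_map n \<kappa> X A id (hclass n \<kappa> X {} z) = hclass n \<kappa> X A z"
    if "z \<in> cycles n \<kappa> X {}" for z
    using dH_map_id_hclass[of "{}" A X X, OF _ _ _ AX that] by simp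
  have d_class: "sub_boundary n \<kappa> A z \<in> cycles (n - 1) \<kappa> A {}
      \<and> dH_connecting n \<kappa> X A (hclass n \<kappa> X A z) = hclass (n - 1) \<kappa> A {} (sub_boundary n \<kappa> A z)"
    if "z \<in> cycles n \<kappa> X A" for z
    using sub_boundary_cycles[OF AX that] dH_connecting_sub_boundary[OF AX that] by simp
  have "kernel (dH n \<kappa> X {}) (dH n \<kappa> X A) (dH_map n \<kappa> X A id) = dH_map n \<kappa> X {} id ` carrier (dH n \<kappa> A {})"
    by (rule kernel_eq_image[OF presentation_dH presentation_dH presentation_dH, where f = id and g = id])
       (simp_all only: id_apply i_class j_class exact_at_absolute[OF AX] AX empty_subsetI)
  moreover have "kernel (dH n \<kappa> X A) (dH (n - 1) \<kappa> A {}) (dH_connecting n \<kappa> X A)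
      = dH_map n \<kappa> X A id ` carrier (dH n \<kappa> X {})"
    by (rule kernel_eq_image[OF presentation_dH presentation_dH presentation_dH, where f = id
          and g = "sub_boundary n \<kappa> A"])
       (simp_all only: id_apply j_class d_class exact_at_relative[OF AX] AX empty_subsetI)
  moreover have "kernel (dH (n - 1) \<kappa> A {}) (dH (n - 1) \<kappa> X {}) (dH_map (n - 1) \<kappa> X {} id)
      = dH_connecting n \<kappa> X A ` carrier (dH n \<kappa> X A)"
    by (rule kernel_eq_image[OF presentation_dH presentation_dH presentation_dH, where g = id
          and f = "sub_boundary n \<kappa> A"])
       (simp_all only: id_apply i_class d_class exact_at_subspace[OF AX] AX empty_subsetI)
  ultimately show ?thesis
    using grp[OF AX] grp[of "{}"] i j d
    by (simp add: group_hom_def group_hom_axioms_def)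
qed

text \<open>The closure of order \<open>k\<close> is the closed ball of radius \<open>k\<close>, so the excision hypothesis says
  that the ball of radius \<open>2 i\<close> about \<open>W\<close> lies in \<open>A\<close>.\<close>

lemma dig_Cl_iff: "y \<in> dig_Cl \<kappa> X C \<longleftrightarrow> y \<in> X \<and> (\<exists>u\<in>C. u \<in> X \<and> (u = y \<or> \<kappa> u y))"
  by (auto simp: dig_Cl_def dig_nbhd_def)

text \<open>One half of the adjunction between closure and interior. It trades an interior on the
  right for a closure on the left.\<close>

lemma dig_Cl_Int_adjoint:
  assumes sym: "\<And>x y. \<kappa> x y \<Longrightarrow> \<kappa> y x" and "C \<subseteq> dig_Int \<kappa> X B"
  shows "dig_Cl \<kappa> X C \<subseteq> B"
  using assms unfolding dig_Cl_def dig_Int_def dig_nbhd_def by blast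

lemma dig_Cl_iterate_subset:
  assumes sym: "\<And>x y. \<kappa> x y \<Longrightarrow> \<kappa> y x"
    and "(dig_Cl \<kappa> X ^^ j) W \<subseteq> (dig_Int \<kappa> X ^^ k) A"
  shows "(dig_Cl \<kappa> X ^^ (k + j)) W \<subseteq> A"
  using assms(2)
proof (induction k arbitrary: j)
  case (Suc k)
  then have "(dig_Cl \<kappa> X ^^ Suc j) W \<subseteq> (dig_Int \<kappa> X ^^ k) A"
    using dig_Cl_Int_adjoint[of \<kappa>, OF sym] by simp
  from Suc.IH[OF this] show ?case by simp
qed simp

lemma dig_Cl_path:
  assumes "x \<in> W" and "(x, y) \<in> {(x, y). x \<in> X \<and> y \<in> X \<and> (x = y \<or> \<kappa> x y)} ^^ n"
  shows "y \<in> (dig_Cl \<kappa> X ^^ n) W"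
  using assms(2)
proof (induction n arbitrary: y)
  case (Suc n)
  then obtain u where "(x, u) \<in> {(x, y). x \<in> X \<and> y \<in> X \<and> (x = y \<or> \<kappa> x y)} ^^ n"
    and u: "u \<in> X" "y \<in> X" "u = y \<or> \<kappa> u y" by auto
  then have "u \<in> (dig_Cl \<kappa> X ^^ n) W" using Suc.IH by blast
  then show ?case using u by (auto simp: dig_Cl_iff)
qed (use assms(1) in simp)

lemma dig_Cl_iterate_mono:
  assumes "C \<subseteq> X" "j \<le> k"
  shows "(dig_Cl \<kappa> X ^^ j) C \<subseteq> (dig_Cl \<kappa> X ^^ k) C"
proof (rule lift_Suc_mono_le[OF _ assms(2)])
  fix m
  have "(dig_Cl \<kappa> X ^^ m) C \<subseteq> X" using assms(1) by (cases m) (auto simp: dig_Cl_def)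
  then show "(dig_Cl \<kappa> X ^^ m) C \<subseteq> (dig_Cl \<kappa> X ^^ Suc m) C"
    by (auto simp: dig_Cl_def dig_nbhd_def)
qed

section \<open>Excision without subdivision\<close>

lemma cubes_excision:
  assumes sym: "\<And>x y. \<kappa> x y \<Longrightarrow> \<kappa> y x" and "W \<subseteq> X"
    and W: "(dig_Cl \<kappa> X ^^ i) W \<subseteq> (dig_Int \<kappa> X ^^ i) A" and n: "n \<le> 2 * int i"
  shows "cubes n \<kappa> X \<subseteq> cubes n \<kappa> A \<union> cubes n \<kappa> (X - W)"
proof
  fix T assume T: "T \<in> cubes n \<kappa> X"
  then have T': "digital_cube (nat n) \<kappa> X T" by (simp add: cubes_def)
  have in_X: "T t \<in> X" if "t \<in> unit_cube (nat n)" for t using T' that by (simp add: digital_cube_iff)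
  show "T \<in> cubes n \<kappa> A \<union> cubes n \<kappa> (X - W)"
  proof (cases "T ` unit_cube (nat n) \<subseteq> X - W")
    case True
    then show ?thesis using T by (auto simp: cubes_def digital_cube_iff)
  next
    case False
    then obtain s where s: "s \<in> unit_cube (nat n)" "T s \<in> W" using in_X by blast
    \<comment> \<open>Of the i + i closures, i stand in the hypothesis and i come from trading in
      the interiors.\<close>
    have "(dig_Cl \<kappa> X ^^ nat n) W \<subseteq> (dig_Cl \<kappa> X ^^ (i + i)) W"
      by (rule dig_Cl_iterate_mono[OF \<open>W \<subseteq> X\<close>]) (use n in simp)
    also have "\<dots> \<subseteq> A" by (rule dig_Cl_iterate_subset[OF _ W]) (rule sym)
    finally have ball: "(dig_Cl \<kappa> X ^^ nat n) W \<subseteq> A" .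
    have "T t \<in> A" if "t \<in> unit_cube (nat n)" for t
      using dig_Cl_path[OF s(2) cube_path[OF T' s(1) that]] ball by blast
    then show ?thesis using T by (auto simp: cubes_def digital_cube_iff)
  qed
qed

text \<open>Checked cube by cube: a cube of A avoiding W lies in A - W, and a degenerate cube
  avoiding W is degenerate in X - W.\<close>

lemma rel_chains_excision:
  assumes "c \<in> chains_on (rel_cubes n \<kappa> X A)" "c \<in> chains_on (cubes n \<kappa> (X - W))"
  shows "c \<in> chains_on (rel_cubes n \<kappa> (X - W) (A - W))"
proof -
  have "rel_cubes n \<kappa> X A \<inter> cubes n \<kappa> (X - W) \<subseteq> rel_cubes n \<kappa> (X - W) (A - W)"
    unfolding rel_cubes_def degenerate_cubes_def cubes_def digital_cube_iff by auto
  then show ?thesis using assms unfolding chains_on_def by blast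
qed

lemma cycles_excision:
  assumes n: "cubes n \<kappa> X \<subseteq> cubes n \<kappa> A \<union> cubes n \<kappa> (X - W)"
    and c: "c \<in> cycles n \<kappa> X A"
  shows "\<exists>c'\<in>cycles n \<kappa> (X - W) (A - W). c - c' \<in> boundaries n \<kappa> X A"
proof -
  obtain a c' where a: "a \<in> chains_on (cubes n \<kappa> A)" and c': "c' \<in> chains_on (cubes n \<kappa> (X - W))"
    and eq: "c = a + c'"
    using c chains_mono[OF n] chains_Un_split[of c "cubes n \<kappa> A" "cubes n \<kappa> (X - W)"]
    by (auto simp: cycles_def)
  have "dQ_boundary n c' = dQ_boundary n c - dQ_boundary n a" using eq by (simp add: dQ_boundary_add)
  also have "\<dots> \<in> chains_on (rel_cubes (n - 1) \<kappa> X A)"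
    using c cubes_chains_rel[OF dQ_boundary_cubes[OF a]] by (intro chains_diff) (auto simp: cycles_def)
  finally have "c' \<in> cycles n \<kappa> (X - W) (A - W)"
    using c' rel_chains_excision dQ_boundary_cubes[OF c'] by (auto simp: cycles_def)
  moreover have "c - c' \<in> boundaries n \<kappa> X A"
    using eq cubes_chains_rel[OF a] by (auto simp: boundaries_def intro!: bexI[of _ 0])
  ultimately show ?thesis by blast
qed

text \<open>Injectivity: here the filling b is split instead of the cycle, hence the condition on
  cubes of dimension n + 1.\<close>

lemma boundaries_excision:
  assumes n: "cubes (n + 1) \<kappa> X \<subseteq> cubes (n + 1) \<kappa> A \<union> cubes (n + 1) \<kappa> (X - W)"
    and c: "c \<in> cycles n \<kappa> (X - W) (A - W)" "c \<in> boundaries n \<kappa> X A"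
  shows "c \<in> boundaries n \<kappa> (X - W) (A - W)"
proof -
  obtain b where b: "b \<in> chains_on (cubes (n + 1) \<kappa> X)"
    and r: "c - dQ_boundary (n + 1) b \<in> chains_on (rel_cubes n \<kappa> X A)"
    using c(2) by (auto simp: boundaries_def)
  have "b \<in> chains_on (cubes (n + 1) \<kappa> A \<union> cubes (n + 1) \<kappa> (X - W))" using b chains_mono[OF n] by blast
  then obtain a b' where a: "a \<in> chains_on (cubes (n + 1) \<kappa> A)"
    and b': "b' \<in> chains_on (cubes (n + 1) \<kappa> (X - W))" and eq: "b = a + b'"
    by (rule chains_Un_split)
  have da: "dQ_boundary (n + 1) a \<in> chains_on (cubes n \<kappa> A)"
    and db: "dQ_boundary (n + 1) b' \<in> chains_on (cubes n \<kappa> (X - W))"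
    using dQ_boundary_cubes[OF a] dQ_boundary_cubes[OF b'] by simp_all
  have "c - dQ_boundary (n + 1) b' = c - dQ_boundary (n + 1) b + dQ_boundary (n + 1) a"
    using eq by (simp add: dQ_boundary_add)
  also have "\<dots> \<in> chains_on (rel_cubes n \<kappa> X A)" by (rule chains_add[OF r cubes_chains_rel[OF da]])
  finally have "c - dQ_boundary (n + 1) b' \<in> chains_on (rel_cubes n \<kappa> (X - W) (A - W))"
    by (rule rel_chains_excision[OF _ chains_diff[OF _ db]]) (use c(1) in \<open>simp add: cycles_def\<close>)
  then show ?thesis using b' by (auto simp: boundaries_def)
qed

lemma dH_excision:
  assumes sym: "\<And>x y. \<kappa> x y \<Longrightarrow> \<kappa> y x" and AX: "A \<subseteq> X" and WA: "W \<subseteq> A"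
    and W: "(dig_Cl \<kappa> X ^^ i) W \<subseteq> (dig_Int \<kappa> X ^^ i) A" and n: "n \<le> 2 * int i"
  shows "dH_map n \<kappa> X A id \<in> epi (dH n \<kappa> (X - W) (A - W)) (dH n \<kappa> X A)"
    and "n < 2 * int i \<Longrightarrow> dH_map n \<kappa> X A id \<in> iso (dH n \<kappa> (X - W) (A - W)) (dH n \<kappa> X A)"
proof -
  have sub: "A - W \<subseteq> X - W" "A - W \<subseteq> A" "X - W \<subseteq> X" "W \<subseteq> X" using AX WA by auto
  interpret E: presentation "dH n \<kappa> (X - W) (A - W)" "cycles n \<kappa> (X - W) (A - W)"
    "boundaries n \<kappa> (X - W) (A - W)" "hclass n \<kappa> (X - W) (A - W)" by (rule presentation_dH[OF sub(1)])
  interpret H: presentation "dH n \<kappa> X A" "cycles n \<kappa> X A" "boundaries n \<kappa> X A" "hclass n \<kappa> X A"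
    by (rule presentation_dH[OF AX])
  note map = dH_map_id_hclass[OF sub(2,3,1) AX, of _ n \<kappa>]
  have cubes: "cubes m \<kappa> X \<subseteq> cubes m \<kappa> A \<union> cubes m \<kappa> (X - W)" if "m \<le> 2 * int i" for m
    by (rule cubes_excision[OF _ sub(4) W that]) (rule sym)
  have hom: "dH_map n \<kappa> X A id \<in> hom (dH n \<kappa> (X - W) (A - W)) (dH n \<kappa> X A)"
    by (rule dH_map_hom[OF pair_map_id[OF sub(2,3)] sub(1) AX])
  have "h \<in> dH_map n \<kappa> X A id ` carrier (dH n \<kappa> (X - W) (A - W))" if h: "h \<in> carrier (dH n \<kappa> X A)" for h
  proof -
    obtain c where c: "c \<in> cycles n \<kappa> X A" "h = hclass n \<kappa> X A c" using AX h by (rule dH_memE)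
    obtain c' where c': "c' \<in> cycles n \<kappa> (X - W) (A - W)" "c - c' \<in> boundaries n \<kappa> X A"
      using cycles_excision[OF cubes[OF n] c(1)] by blast
    then have "h = dH_map n \<kappa> X A id (hclass n \<kappa> (X - W) (A - W) c')"
      using c H.eq_iff map by simp
    then show ?thesis using E.closed[OF c'(1)] by blast
  qed
  then have surj: "dH_map n \<kappa> X A id ` carrier (dH n \<kappa> (X - W) (A - W)) = carrier (dH n \<kappa> X A)"
    using hom by (auto simp: hom_def)
  then show "dH_map n \<kappa> X A id \<in> epi (dH n \<kappa> (X - W) (A - W)) (dH n \<kappa> X A)"
    using hom by (simp add: epi_def)
  assume "n < 2 * int i"
  then have n1: "n + 1 \<le> 2 * int i" by simp
  have "inj_on (dH_map n \<kappa> X A id) (carrier (dH n \<kappa> (X - W) (A - W)))"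
    unfolding E.image_Z[symmetric]
  proof (rule inj_onI, clarsimp)
    fix c d assume c: "c \<in> cycles n \<kappa> (X - W) (A - W)" and d: "d \<in> cycles n \<kappa> (X - W) (A - W)"
      and "dH_map n \<kappa> X A id (hclass n \<kappa> (X - W) (A - W) c) = dH_map n \<kappa> X A id (hclass n \<kappa> (X - W) (A - W) d)"
    then have "c - d \<in> boundaries n \<kappa> X A" using H.eq_iff map by simp
    then have "c - d \<in> boundaries n \<kappa> (X - W) (A - W)"
      by (rule boundaries_excision[OF cubes[OF n1] add_closed_diff[OF cycles_closed c d]])
    then show "hclass n \<kappa> (X - W) (A - W) c = hclass n \<kappa> (X - W) (A - W) d" using E.eq_iff c d by blast
  qed
  then show "dH_map n \<kappa> X A id \<in> iso (dH n \<kappa> (X - W) (A - W)) (dH n \<kappa> X A)"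
    using hom surj by (simp add: iso_def bij_betw_def)
qed

text \<open>All cubes are constant, hence idle in coordinate 0, which exists as n is positive. So
  every cycle is degenerate.\<close>

lemma dH_point:
  assumes "0 < n"
  shows "trivial_group (dH n \<kappa> {x} {})"
proof -
  interpret presentation "dH n \<kappa> {x} {}" "cycles n \<kappa> {x} {}" "boundaries n \<kappa> {x} {}" "hclass n \<kappa> {x} {}"
    by (rule presentation_dH) simp
  have "degenerate_cube (nat n) T" if "T \<in> cubes n \<kappa> {x}" for T
  proof -
    have "T t = x" if "t \<in> unit_cube (nat n)" for t
      using \<open>T \<in> _\<close> that by (auto simp: cubes_def digital_cube_iff)
    then have "T (t[0 := s]) = T t" if "t \<in> unit_cube (nat n)" "s \<in> {0, 1}" for t s
      using that update_unit_cube by metis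
    then show ?thesis using assms unfolding degenerate_cube_def by (metis zero_less_nat_eq)
  qed
  then have "cubes n \<kappa> {x} \<subseteq> degenerate_cubes n \<kappa> {x}" by (auto simp: degenerate_cubes_def)
  then have "cycles n \<kappa> {x} {} \<subseteq> boundaries n \<kappa> {x} {}"
    using chains_mono by (fastforce simp: cycles_def boundaries_def intro!: bexI[of _ 0])
  then have "hclass n \<kappa> {x} {} c = \<one>\<^bsub>dH n \<kappa> {x} {}\<^esub>" if "c \<in> cycles n \<kappa> {x} {}" for c
    using one_iff that by blast
  then have "carrier (dH n \<kappa> {x} {}) = {\<one>\<^bsub>dH n \<kappa> {x} {}\<^esub>}"
    using image_Z[symmetric] one_closed by auto
  then show ?thesis by (simp add: trivial_group_def is_group)
qed

section \<open>Additivity\<close>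

text \<open>Projection commutes with the boundary as soon as the boundaries of the discarded cubes
  contribute no cube of A.\<close>

lemma frag_restrict_boundary:
  assumes c: "c \<in> chains_on (S \<union> cubes n \<kappa> A)"
    and disj: "cubes n \<kappa> A \<inter> S = {}"
    and S: "\<And>T. T \<in> S \<Longrightarrow> cube_boundary (nat n) T \<in> chains_on S'" and disj': "cubes (n - 1) \<kappa> A \<inter> S' = {}"
  shows "frag_restrict (cubes (n - 1) \<kappa> A) (dQ_boundary n c)
    = dQ_boundary n (frag_restrict (cubes n \<kappa> A) c)"
  using c
proof (induction rule: chains_induct)
  case (one T)
  show ?case
  proof (cases "T \<in> cubes n \<kappa> A")
    case True
    then show ?thesis
      using dQ_boundary_cubes[of "frag_of T" n \<kappa> A] by (simp add: frag_restrict_simps frag_restrict_ident)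
  next
    case False
    then have "T \<in> S" using one by simp
    then show ?thesis
      using False frag_restrict_disjoint[OF S disj'] by (simp add: frag_restrict_simps dQ_boundary_def)
  qed
qed (simp_all add: frag_restrict_simps dQ_boundary_diff)

locale disconnected_family =
  fixes \<kappa> :: "'a \<Rightarrow> 'a \<Rightarrow> bool" and \<Lambda> :: "'i set" and X :: "'i \<Rightarrow> 'a set"
  assumes disconnected:
    "pairwise (\<lambda>\<alpha> \<beta>. disjnt (X \<alpha>) (X \<beta>) \<and> dig_disconnected \<kappa> (X \<alpha>) (X \<beta>)) \<Lambda>"
begin

abbreviation U :: "'a set" where "U \<equiv> (\<Union>\<alpha>\<in>\<Lambda>. X \<alpha>)"

lemma cubes_Union: "cubes n \<kappa> U = (\<Union>\<alpha>\<in>\<Lambda>. cubes n \<kappa> (X \<alpha>))"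
proof
  show "(\<Union>\<alpha>\<in>\<Lambda>. cubes n \<kappa> (X \<alpha>)) \<subseteq> cubes n \<kappa> U"
    by (intro UN_least cubes_mono) blast
  show "cubes n \<kappa> U \<subseteq> (\<Union>\<alpha>\<in>\<Lambda>. cubes n \<kappa> (X \<alpha>))"
  proof
    fix T assume T: "T \<in> cubes n \<kappa> U"
    then have T': "digital_cube (nat n) \<kappa> U T" by (simp add: cubes_def)
    define s where "s = replicate (nat n) (0::int)"
    have s: "s \<in> unit_cube (nat n)" by (auto simp: s_def unit_cube_def)
    then obtain \<alpha> where \<alpha>: "\<alpha> \<in> \<Lambda>" "T s \<in> X \<alpha>" using T' by (auto simp: digital_cube_iff)
    have step: "y \<in> X \<alpha>" if "x \<in> X \<alpha>" "y \<in> U" "x = y \<or> \<kappa> x y" for x y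
    proof (rule ccontr)
      assume "y \<notin> X \<alpha>"
      with that(2) obtain \<beta> where "\<beta> \<in> \<Lambda>" "y \<in> X \<beta>" "\<beta> \<noteq> \<alpha>" by auto
      then show False
        using disconnected \<alpha>(1) that \<open>y \<notin> X \<alpha>\<close> unfolding pairwise_def dig_disconnected_def by metis
    qed
    have "y \<in> X \<alpha>" if "(T s, y) \<in> {(x, y). x \<in> U \<and> y \<in> U \<and> (x = y \<or> \<kappa> x y)} ^^ k" for k y
      using that
    proof (induction k arbitrary: y)
      case (Suc k)
      then obtain x where "(T s, x) \<in> {(x, y). x \<in> U \<and> y \<in> U \<and> (x = y \<or> \<kappa> x y)} ^^ k"
        and xy: "y \<in> U" "x = y \<or> \<kappa> x y" by auto
      with Suc.IH have "x \<in> X \<alpha>" by blast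
      then show ?case using step xy by blast
    qed (use \<alpha>(2) in simp)
    then have "T t \<in> X \<alpha>" if "t \<in> unit_cube (nat n)" for t
      using cube_path[OF T' s that] by blast
    then have "T \<in> cubes n \<kappa> (X \<alpha>)" using T by (auto simp: cubes_def digital_cube_iff)
    then show "T \<in> (\<Union>\<alpha>\<in>\<Lambda>. cubes n \<kappa> (X \<alpha>))" using \<alpha>(1) by blast
  qed
qed

text \<open>Every cube, even of dimension 0, has a value at the zero vertex, and that value would be
  common to both components.\<close>

lemma cubes_disjoint:
  assumes "\<alpha> \<in> \<Lambda>" "\<beta> \<in> \<Lambda>" "\<alpha> \<noteq> \<beta>"
  shows "cubes n \<kappa> (X \<alpha>) \<inter> cubes n \<kappa> (X \<beta>) = {}"
proof -
  have "replicate (nat n) 0 \<in> unit_cube (nat n)" by (auto simp: unit_cube_def)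
  moreover have "X \<alpha> \<inter> X \<beta> = {}" using disconnected assms by (auto simp: pairwise_def disjnt_def)
  ultimately show ?thesis unfolding cubes_def digital_cube_iff by blast
qed

abbreviation part :: "int \<Rightarrow> 'i \<Rightarrow> 'a cube_chain \<Rightarrow> 'a cube_chain" where
  "part n \<alpha> \<equiv> frag_restrict (cubes n \<kappa> (X \<alpha>))"

lemma part_boundary:
  assumes "\<alpha> \<in> \<Lambda>" "c \<in> chains_on (cubes n \<kappa> U)"
  shows "part (n - 1) \<alpha> (dQ_boundary n c) = dQ_boundary n (part n \<alpha> c)"
proof (rule frag_restrict_boundary)
  let ?S = "\<lambda>k. \<Union>\<beta>\<in>\<Lambda> - {\<alpha>}. cubes k \<kappa> (X \<beta>)"
  show "c \<in> chains_on (?S n \<union> cubes n \<kappa> (X \<alpha>))"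
    using assms(2) chains_mono[of "cubes n \<kappa> U" "?S n \<union> cubes n \<kappa> (X \<alpha>)"] by (auto simp: cubes_Union)
  show "cubes n \<kappa> (X \<alpha>) \<inter> ?S n = {}" "cubes (n - 1) \<kappa> (X \<alpha>) \<inter> ?S (n - 1) = {}"
    using cubes_disjoint[OF assms(1)] by blast+
  show "cube_boundary (nat n) T \<in> chains_on (?S (n - 1))" if "T \<in> ?S n" for T
  proof -
    obtain \<beta> where \<beta>: "\<beta> \<in> \<Lambda> - {\<alpha>}" "T \<in> cubes n \<kappa> (X \<beta>)" using \<open>T \<in> ?S n\<close> by blast
    have "cube_boundary (nat n) T \<in> chains_on (cubes (n - 1) \<kappa> (X \<beta>))"
      using dQ_boundary_cubes[of "frag_of T" n \<kappa> "X \<beta>"] \<beta>(2) by (simp add: dQ_boundary_def)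
    then show ?thesis using chains_mono[of "cubes (n - 1) \<kappa> (X \<beta>)" "?S (n - 1)"] \<beta>(1) by blast
  qed
qed

lemma part_degenerate:
  assumes "\<alpha> \<in> \<Lambda>" "c \<in> chains_on (degenerate_cubes n \<kappa> U)"
  shows "part n \<alpha> c \<in> chains_on (degenerate_cubes n \<kappa> (X \<alpha>))"
  using frag_restrict_chains[OF assms(2), of "cubes n \<kappa> (X \<alpha>)"] degenerate_cubes_Int[OF UN_upper[OF assms(1)], of n \<kappa>]
  by (simp add: Int_commute)

lemma part_cycles:
  assumes "\<alpha> \<in> \<Lambda>" "c \<in> cycles n \<kappa> U {}"
  shows "part n \<alpha> c \<in> cycles n \<kappa> (X \<alpha>) {}"
  using assms part_degenerate[OF assms(1), of "dQ_boundary n c" "n - 1"] part_boundary[OF assms(1), of c n]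
  by (auto simp: cycles_def frag_restrict_chains_left)

lemma sum_parts:
  assumes "finite F" "F \<subseteq> \<Lambda>" "c \<in> chains_on (\<Union>\<alpha>\<in>F. cubes n \<kappa> (X \<alpha>))"
  shows "(\<Sum>\<alpha>\<in>F. part n \<alpha> c) = c"
  using assms(3)
proof (induction rule: chains_induct)
  case (one T)
  then obtain \<beta> where \<beta>: "\<beta> \<in> F" "T \<in> cubes n \<kappa> (X \<beta>)" by blast
  then have "part n \<alpha> (frag_of T) = (if \<alpha> = \<beta> then frag_of T else 0)" if "\<alpha> \<in> F" for \<alpha>
    using that cubes_disjoint[of \<alpha> \<beta> n] assms(2) by (auto simp: frag_restrict_simps)
  then show ?case using assms(1) \<beta>(1) by simp
qed (simp_all add: frag_restrict_simps sum_subtractf)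

text \<open>The index set may be infinite. The finite support of a chain provides the finite support
  that \<open>sum_group\<close> demands.\<close>

lemma finite_parts:
  assumes "c \<in> chains_on (cubes n \<kappa> U)"
  obtains F where "finite F" "F \<subseteq> \<Lambda>" "c \<in> chains_on (\<Union>\<alpha>\<in>F. cubes n \<kappa> (X \<alpha>))"
    "\<And>\<alpha>. \<alpha> \<in> \<Lambda> - F \<Longrightarrow> part n \<alpha> c = 0"
proof -
  have "\<forall>T\<in>Poly_Mapping.keys c. \<exists>\<alpha>. \<alpha> \<in> \<Lambda> \<and> T \<in> cubes n \<kappa> (X \<alpha>)"
    using assms cubes_Union[of n] by (auto simp: chains_on_def)
  then obtain a where a: "\<And>T. T \<in> Poly_Mapping.keys c \<Longrightarrow> a T \<in> \<Lambda> \<and> T \<in> cubes n \<kappa> (X (a T))"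
    by metis
  let ?F = "a ` Poly_Mapping.keys c"
  have c: "c \<in> chains_on (\<Union>\<alpha>\<in>?F. cubes n \<kappa> (X \<alpha>))" using a by (auto simp: chains_on_def)
  show thesis
  proof (rule that[of ?F])
    show "part n \<alpha> c = 0" if "\<alpha> \<in> \<Lambda> - ?F" for \<alpha>
    proof (rule frag_restrict_disjoint[OF c])
      have "cubes n \<kappa> (X \<alpha>) \<inter> cubes n \<kappa> (X \<beta>) = {}" if "\<beta> \<in> ?F" for \<beta>
        using cubes_disjoint[of \<alpha> \<beta> n] that a \<open>\<alpha> \<in> \<Lambda> - ?F\<close> by blast
      then show "cubes n \<kappa> (X \<alpha>) \<inter> (\<Union>\<beta>\<in>?F. cubes n \<kappa> (X \<beta>)) = {}" by blast
    qed
  qed (use a c in auto)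
qed

lemma boundaries_parts:
  assumes c: "c \<in> chains_on (cubes n \<kappa> U)"
  shows "c \<in> boundaries n \<kappa> U {} \<longleftrightarrow> (\<forall>\<alpha>\<in>\<Lambda>. part n \<alpha> c \<in> boundaries n \<kappa> (X \<alpha>) {})"
proof
  assume "c \<in> boundaries n \<kappa> U {}"
  then obtain b where b: "b \<in> chains_on (cubes (n + 1) \<kappa> U)"
    and e: "c - dQ_boundary (n + 1) b \<in> chains_on (degenerate_cubes n \<kappa> U)" by (auto simp: boundaries_def)
  have "part n \<alpha> c - dQ_boundary (n + 1) (part (n + 1) \<alpha> b) \<in> chains_on (degenerate_cubes n \<kappa> (X \<alpha>))"
    if "\<alpha> \<in> \<Lambda>" for \<alpha>
    using part_degenerate[OF that e] part_boundary[OF that b] by (simp add: frag_restrict_simps)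
  then show "\<forall>\<alpha>\<in>\<Lambda>. part n \<alpha> c \<in> boundaries n \<kappa> (X \<alpha>) {}"
    using frag_restrict_chains_left by (auto simp: boundaries_def)
next
  assume R: "\<forall>\<alpha>\<in>\<Lambda>. part n \<alpha> c \<in> boundaries n \<kappa> (X \<alpha>) {}"
  obtain F where F: "finite F" "F \<subseteq> \<Lambda>" "c \<in> chains_on (\<Union>\<alpha>\<in>F. cubes n \<kappa> (X \<alpha>))"
    using c by (rule finite_parts)
  have "\<forall>\<alpha>\<in>\<Lambda>. \<exists>b. b \<in> chains_on (cubes (n + 1) \<kappa> (X \<alpha>))
      \<and> part n \<alpha> c - dQ_boundary (n + 1) b \<in> chains_on (degenerate_cubes n \<kappa> (X \<alpha>))"
    using R by (auto simp: boundaries_def)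
  then obtain b where b: "\<And>\<alpha>. \<alpha> \<in> \<Lambda> \<Longrightarrow> b \<alpha> \<in> chains_on (cubes (n + 1) \<kappa> (X \<alpha>))"
    and e: "\<And>\<alpha>. \<alpha> \<in> \<Lambda> \<Longrightarrow> part n \<alpha> c - dQ_boundary (n + 1) (b \<alpha>) \<in> chains_on (degenerate_cubes n \<kappa> (X \<alpha>))"
    by metis
  have sub: "X \<alpha> \<subseteq> U" if "\<alpha> \<in> F" for \<alpha> using that F(2) by blast
  \<comment> \<open>Only the fillings over the finite set F are added up; this suffices because c is
    the sum of its parts over F.\<close>
  have "dQ_boundary (n + 1) (\<Sum>\<alpha>\<in>F. b \<alpha>) = (\<Sum>\<alpha>\<in>F. dQ_boundary (n + 1) (b \<alpha>))"
    using F(1) by (simp add: dQ_boundary_def frag_extend_sum o_def)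
  then have "c - dQ_boundary (n + 1) (\<Sum>\<alpha>\<in>F. b \<alpha>) = (\<Sum>\<alpha>\<in>F. part n \<alpha> c - dQ_boundary (n + 1) (b \<alpha>))"
    using sum_parts[OF F] by (simp add: sum_subtractf)
  also have "\<dots> \<in> chains_on (degenerate_cubes n \<kappa> U)"
    by (rule chains_sum, rule degenerate_chains_mono[OF sub e]) (use F(2) in auto)
  finally have "c - dQ_boundary (n + 1) (\<Sum>\<alpha>\<in>F. b \<alpha>) \<in> chains_on (degenerate_cubes n \<kappa> U)" .
  moreover have "(\<Sum>\<alpha>\<in>F. b \<alpha>) \<in> chains_on (cubes (n + 1) \<kappa> U)"
    by (rule chains_sum, rule cubes_chains_mono[OF sub b]) (use F(2) in auto)
  ultimately show "c \<in> boundaries n \<kappa> U {}" unfolding boundaries_def by auto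
qed

text \<open>Supplies preimages for surjectivity onto the direct sum, whose elements are trivial
  outside a finite set of indices.\<close>

lemma glue_parts:
  assumes F: "finite F" "F \<subseteq> \<Lambda>" and z: "\<And>\<alpha>. \<alpha> \<in> F \<Longrightarrow> z \<alpha> \<in> cycles n \<kappa> (X \<alpha>) {}"
  shows "(\<Sum>\<alpha>\<in>F. z \<alpha>) \<in> cycles n \<kappa> U {}"
    "\<And>\<beta>. \<beta> \<in> \<Lambda> \<Longrightarrow> part n \<beta> (\<Sum>\<alpha>\<in>F. z \<alpha>) = (if \<beta> \<in> F then z \<beta> else 0)"
proof -
  have zc: "z \<alpha> \<in> chains_on (cubes n \<kappa> (X \<alpha>))" if "\<alpha> \<in> F" for \<alpha>
    using z[OF that] by (simp add: cycles_def)
  have sub: "X \<alpha> \<subseteq> U" if "\<alpha> \<in> F" for \<alpha> using that F(2) by blast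
  have "dQ_boundary n (\<Sum>\<alpha>\<in>F. z \<alpha>) = (\<Sum>\<alpha>\<in>F. dQ_boundary n (z \<alpha>))"
    using F(1) by (simp add: dQ_boundary_def frag_extend_sum o_def)
  also have "\<dots> \<in> chains_on (degenerate_cubes (n - 1) \<kappa> U)"
    by (rule chains_sum, rule degenerate_chains_mono[OF sub]) (use z in \<open>auto simp: cycles_def\<close>)
  finally show "(\<Sum>\<alpha>\<in>F. z \<alpha>) \<in> cycles n \<kappa> U {}"
    using chains_sum[of F z "cubes n \<kappa> U"] cubes_chains_mono[OF sub zc] by (simp add: cycles_def)
  fix \<beta> assume \<beta>: "\<beta> \<in> \<Lambda>"
  have "part n \<beta> (\<Sum>\<alpha>\<in>F. z \<alpha>) = (\<Sum>\<alpha>\<in>F. part n \<beta> (z \<alpha>))"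
    using F(1) by (simp add: frag_restrict_def frag_extend_sum o_def)
  also have "\<dots> = (\<Sum>\<alpha>\<in>F. if \<alpha> = \<beta> then z \<beta> else 0)"
  proof (rule sum.cong)
    fix \<alpha> assume \<alpha>: "\<alpha> \<in> F"
    show "part n \<beta> (z \<alpha>) = (if \<alpha> = \<beta> then z \<beta> else 0)"
      using zc[OF \<alpha>] cubes_disjoint[of \<beta> \<alpha> n] \<beta> \<alpha> F(2)
      by (auto simp: frag_restrict_ident intro!: frag_restrict_disjoint)
  qed simp
  finally show "part n \<beta> (\<Sum>\<alpha>\<in>F. z \<alpha>) = (if \<beta> \<in> F then z \<beta> else 0)" using F(1) by simp
qed

text \<open>The family of parts presents the direct sum by the cycles of the union, with the same
  null chains as the homology of the union.\<close>

lemma dH_additive: "dH n \<kappa> U {} \<cong> sum_group \<Lambda> (\<lambda>\<alpha>. dH n \<kappa> (X \<alpha>) {})" (is "_ \<cong> ?S")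
proof (rule presentation.isomorphic[OF presentation_dH])
  interpret H: presentation "dH n \<kappa> (X \<alpha>) {}" "cycles n \<kappa> (X \<alpha>) {}" "boundaries n \<kappa> (X \<alpha>) {}"
    "hclass n \<kappa> (X \<alpha>) {}" for \<alpha> by (rule presentation_dH) simp
  interpret S: group ?S by (rule sum_group) (rule H.is_group)
  have carrier_S: "carrier ?S = {x \<in> \<Pi>\<^sub>E \<alpha>\<in>\<Lambda>. carrier (dH n \<kappa> (X \<alpha>) {}). finite {\<alpha> \<in> \<Lambda>. x \<alpha> \<noteq> \<one>\<^bsub>dH n \<kappa> (X \<alpha>) {}\<^esub>}}"
    by (rule carrier_sum_group) (rule H.is_group)
  interpret S: comm_group ?S
    by (rule S.group_comm_groupI) (auto simp: carrier_S intro!: restrict_ext H.m_comm)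
  let ?\<psi> = "\<lambda>c. \<lambda>\<alpha>\<in>\<Lambda>. hclass n \<kappa> (X \<alpha>) {} (part n \<alpha> c)"
  show "presentation ?S (cycles n \<kappa> U {}) (boundaries n \<kappa> U {}) ?\<psi>"
  proof
    show "?\<psi> ` cycles n \<kappa> U {} = carrier ?S"
    proof
      show "?\<psi> ` cycles n \<kappa> U {} \<subseteq> carrier ?S"
      proof clarify
        fix c assume c: "c \<in> cycles n \<kappa> U {}"
        then have "c \<in> chains_on (cubes n \<kappa> U)" by (simp add: cycles_def)
        then obtain F where F: "finite F" "\<And>\<alpha>. \<alpha> \<in> \<Lambda> - F \<Longrightarrow> part n \<alpha> c = 0" by (rule finite_parts) blast
        have "{\<alpha> \<in> \<Lambda>. ?\<psi> c \<alpha> \<noteq> \<one>\<^bsub>dH n \<kappa> (X \<alpha>) {}\<^esub>} \<subseteq> F" using F(2) H.zero by fastforce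
        then have "finite {\<alpha> \<in> \<Lambda>. ?\<psi> c \<alpha> \<noteq> \<one>\<^bsub>dH n \<kappa> (X \<alpha>) {}\<^esub>}" using F(1) finite_subset by blast
        moreover have "?\<psi> c \<in> (\<Pi>\<^sub>E \<alpha>\<in>\<Lambda>. carrier (dH n \<kappa> (X \<alpha>) {}))"
          using H.closed part_cycles[OF _ c] by auto
        ultimately show "?\<psi> c \<in> carrier ?S" unfolding carrier_S by blast
      qed
      show "carrier ?S \<subseteq> ?\<psi> ` cycles n \<kappa> U {}"
      proof
        fix x assume "x \<in> carrier ?S"
        then have x: "x \<in> (\<Pi>\<^sub>E \<alpha>\<in>\<Lambda>. carrier (dH n \<kappa> (X \<alpha>) {}))"
          and fin: "finite {\<alpha> \<in> \<Lambda>. x \<alpha> \<noteq> \<one>\<^bsub>dH n \<kappa> (X \<alpha>) {}\<^esub>}" (is "finite ?F") by (auto simp: carrier_S)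
        have "\<forall>\<alpha>\<in>\<Lambda>. \<exists>z. z \<in> cycles n \<kappa> (X \<alpha>) {} \<and> x \<alpha> = hclass n \<kappa> (X \<alpha>) {} z"
          using x dH_memE[OF empty_subsetI] by (metis PiE_mem)
        then obtain z where z: "\<And>\<alpha>. \<alpha> \<in> \<Lambda> \<Longrightarrow> z \<alpha> \<in> cycles n \<kappa> (X \<alpha>) {}"
          "\<And>\<alpha>. \<alpha> \<in> \<Lambda> \<Longrightarrow> x \<alpha> = hclass n \<kappa> (X \<alpha>) {} (z \<alpha>)" by metis
        have F: "?F \<subseteq> \<Lambda>" by blast
        have zF: "z \<alpha> \<in> cycles n \<kappa> (X \<alpha>) {}" if "\<alpha> \<in> ?F" for \<alpha> using z(1) that by blast
        have glue: "(\<Sum>\<alpha>\<in>?F. z \<alpha>) \<in> cycles n \<kappa> U {}" by (rule glue_parts(1)[OF fin F]) (rule zF)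
        have "x = ?\<psi> (\<Sum>\<alpha>\<in>?F. z \<alpha>)"
        proof (rule extensionalityI[of _ \<Lambda>])
          show "x \<in> extensional \<Lambda>" using x by (simp add: PiE_def)
          fix \<beta> assume \<beta>: "\<beta> \<in> \<Lambda>"
          have "part n \<beta> (\<Sum>\<alpha>\<in>?F. z \<alpha>) = (if \<beta> \<in> ?F then z \<beta> else 0)"
            by (rule glue_parts(2)[OF fin F _ \<beta>]) (rule zF)
          \<comment> \<open>Off the set ?F both sides are the neutral element: x by the choice of
            ?F, the right-hand side because the part is 0.\<close>
          then show "x \<beta> = ?\<psi> (\<Sum>\<alpha>\<in>?F. z \<alpha>) \<beta>"
            using \<beta> z(2)[OF \<beta>] H.zero by simp
        qed simp
        then show "x \<in> ?\<psi> ` cycles n \<kappa> U {}" using glue by blast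
      qed
    qed
    show "?\<psi> (a + b) = ?\<psi> a \<otimes>\<^bsub>?S\<^esub> ?\<psi> b" if "a \<in> cycles n \<kappa> U {}" "b \<in> cycles n \<kappa> U {}" for a b
      using that by (auto simp: frag_restrict_simps H.add part_cycles intro!: restrict_ext)
    show "?\<psi> c = \<one>\<^bsub>?S\<^esub> \<longleftrightarrow> c \<in> boundaries n \<kappa> U {}" if c: "c \<in> cycles n \<kappa> U {}" for c
    proof -
      have "?\<psi> c = \<one>\<^bsub>?S\<^esub> \<longleftrightarrow> (\<forall>\<alpha>\<in>\<Lambda>. hclass n \<kappa> (X \<alpha>) {} (part n \<alpha> c) = \<one>\<^bsub>dH n \<kappa> (X \<alpha>) {}\<^esub>)"
        by (auto simp: fun_eq_iff restrict_def)
      also have "\<dots> \<longleftrightarrow> (\<forall>\<alpha>\<in>\<Lambda>. part n \<alpha> c \<in> boundaries n \<kappa> (X \<alpha>) {})"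
        using H.one_iff part_cycles[OF _ c] by simp
      also have "\<dots> \<longleftrightarrow> c \<in> boundaries n \<kappa> U {}"
        using c by (intro boundaries_parts[symmetric]) (simp add: cycles_def)
      finally show ?thesis .
    qed
  qed (rule cycles_closed)
qed simp

end

section \<open>The axioms for the adjacencies \<open>c_adj l\<close>\<close>

lemma c_adj_sym: "c_adj l p q \<Longrightarrow> c_adj l q p"
proof -
  assume pq: "c_adj l p q"
  then have "length p = length q" by (simp add: c_adj_def)
  then have "{i. i < length q \<and> q ! i \<noteq> p ! i} = {i. i < length p \<and> p ! i \<noteq> q ! i}" by metis
  then show ?thesis using pq unfolding c_adj_def by (metis abs_minus_commute)
qed

theorem theorem6p3:
  shows
  "\<comment> \<open>functoriality: objects, morphisms, identities, composition\<close>
   (\<forall>(n::int) d l X A. digital_pair d l X A \<longrightarrow> comm_group (dH n (c_adj l) X A))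
 \<and> (\<forall>(n::int) d l X A d' l' Y B f.
      digital_pair d l X A \<longrightarrow> digital_pair d' l' Y B \<longrightarrow>
      pair_map (c_adj l) X A (c_adj l') Y B f \<longrightarrow>
      dH_map n (c_adj l') Y B f \<in> hom (dH n (c_adj l) X A) (dH n (c_adj l') Y B))
 \<and> (\<forall>(n::int) d l X A. digital_pair d l X A \<longrightarrow>
      (\<forall>h\<in>carrier (dH n (c_adj l) X A). dH_map n (c_adj l) X A id h = h))
 \<and> (\<forall>(n::int) d l X A d' l' Y B d'' l'' Z C f g.
      digital_pair d l X A \<longrightarrow> digital_pair d' l' Y B \<longrightarrow> digital_pair d'' l'' Z C \<longrightarrow>
      pair_map (c_adj l) X A (c_adj l') Y B f \<longrightarrow> pair_map (c_adj l') Y B (c_adj l'') Z C g \<longrightarrow>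
      (\<forall>h\<in>carrier (dH n (c_adj l) X A).
         dH_map n (c_adj l'') Z C (g \<circ> f) h
           = dH_map n (c_adj l'') Z C g (dH_map n (c_adj l') Y B f h)))
  \<comment> \<open>the connecting maps are homomorphisms and natural\<close>
 \<and> (\<forall>(n::int) d l X A. digital_pair d l X A \<longrightarrow>
      dH_connecting n (c_adj l) X A \<in> hom (dH n (c_adj l) X A) (dH (n - 1) (c_adj l) A {}))
 \<and> (\<forall>(n::int) d l X A d' l' Y B f.
      digital_pair d l X A \<longrightarrow> digital_pair d' l' Y B \<longrightarrow>
      pair_map (c_adj l) X A (c_adj l') Y B f \<longrightarrow>
      (\<forall>h\<in>carrier (dH n (c_adj l) X A).
         dH_map (n - 1) (c_adj l') B {} f (dH_connecting n (c_adj l) X A h)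
           = dH_connecting n (c_adj l') Y B (dH_map n (c_adj l') Y B f h)))
  \<comment> \<open>Homotopy\<close>
 \<and> (\<forall>(n::int) d l X A d' l' Y B f g.
      digital_pair d l X A \<longrightarrow> digital_pair d' l' Y B \<longrightarrow>
      pair_map (c_adj l) X A (c_adj l') Y B f \<longrightarrow> pair_map (c_adj l) X A (c_adj l') Y B g \<longrightarrow>
      pair_homotopic (c_adj l) X A (c_adj l') Y B f g \<longrightarrow>
      (\<forall>h\<in>carrier (dH n (c_adj l) X A).
         dH_map n (c_adj l') Y B f h = dH_map n (c_adj l') Y B g h))
  \<comment> \<open>Exactness; the library lists the groups and maps from right to left\<close>
 \<and> (\<forall>(n::int) d l X A. digital_pair d l X A \<longrightarrow>
      exact_seq
        ([dH (n - 1) (c_adj l) X {}, dH (n - 1) (c_adj l) A {}, dH n (c_adj l) X A,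
          dH n (c_adj l) X {}, dH n (c_adj l) A {}],
         [dH_map (n - 1) (c_adj l) X {} id, dH_connecting n (c_adj l) X A,
          dH_map n (c_adj l) X A id, dH_map n (c_adj l) X {} id]))
  \<comment> \<open>Excision. For i = 1, n = 2 only surjectivity is claimed; injectivity fails for l = d = 3,
    X = {0,1}^3, A = X - {(1,1,1)}, W = {(0,0,0)}\<close>
 \<and> (\<forall>d l X A W (i::nat) (n::int). digital_pair d l X A \<longrightarrow> W \<subseteq> A \<longrightarrow> 1 \<le> i \<longrightarrow>
      (dig_Cl (c_adj l) X ^^ i) W \<subseteq> (dig_Int (c_adj l) X ^^ i) A \<longrightarrow>
      0 \<le> n \<longrightarrow> n \<le> int i + 1 \<longrightarrow>
      dH_map n (c_adj l) X A id \<in>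
        (if i = 1 \<and> n = 2 then epi (dH n (c_adj l) (X - W) (A - W)) (dH n (c_adj l) X A)
         else iso (dH n (c_adj l) (X - W) (A - W)) (dH n (c_adj l) X A)))
  \<comment> \<open>Dimension\<close>
 \<and> (\<forall>(n::int) d l x\<^sub>0. digital_image d l {x\<^sub>0} \<longrightarrow> 0 < n \<longrightarrow>
      trivial_group (dH n (c_adj l) {x\<^sub>0} {}))
  \<comment> \<open>Additivity. As no point is adjacent to itself, disjointness has to be required separately\<close>
 \<and> (\<forall>(n::int) d l (\<Lambda>::'i set) X.
      (\<forall>\<alpha>\<in>\<Lambda>. digital_image d l (X \<alpha>)) \<longrightarrow>
      pairwise (\<lambda>\<alpha> \<beta>. disjnt (X \<alpha>) (X \<beta>) \<and> dig_disconnected (c_adj l) (X \<alpha>) (X \<beta>)) \<Lambda> \<longrightarrow>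
      digital_image d l (\<Union>\<alpha>\<in>\<Lambda>. X \<alpha>) \<longrightarrow>
      dH n (c_adj l) (\<Union>\<alpha>\<in>\<Lambda>. X \<alpha>) {} \<cong> sum_group \<Lambda> (\<lambda>\<alpha>. dH n (c_adj l) (X \<alpha>) {}))"
proof (intro conjI allI impI ballI)
  fix n :: int and d l X A
  assume pair: "digital_pair d l X A"
  then have AX: "A \<subseteq> X" by (simp add: digital_pair_def)
  show "comm_group (dH n (c_adj l) X A)" by (rule dH_comm_group[OF AX])
  show "dH_map n (c_adj l) X A id h = h" if "h \<in> carrier (dH n (c_adj l) X A)" for h
    by (rule dH_map_id[OF AX that])
  show "dH_connecting n (c_adj l) X A \<in> hom (dH n (c_adj l) X A) (dH (n - 1) (c_adj l) A {})"
    by (rule dH_connecting_hom[OF AX])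
  show "exact_seq
        ([dH (n - 1) (c_adj l) X {}, dH (n - 1) (c_adj l) A {}, dH n (c_adj l) X A,
          dH n (c_adj l) X {}, dH n (c_adj l) A {}],
         [dH_map (n - 1) (c_adj l) X {} id, dH_connecting n (c_adj l) X A,
          dH_map n (c_adj l) X A id, dH_map n (c_adj l) X {} id])"
    by (rule dH_exact[OF AX])
  fix d' l' Y B f
  assume pair': "digital_pair d' l' Y B" and f: "pair_map (c_adj l) X A (c_adj l') Y B f"
  then have BY: "B \<subseteq> Y" by (simp add: digital_pair_def)
  show "dH_map n (c_adj l') Y B f \<in> hom (dH n (c_adj l) X A) (dH n (c_adj l') Y B)"
    by (rule dH_map_hom[OF f AX BY])
  fix h assume h: "h \<in> carrier (dH n (c_adj l) X A)"
  show "dH_map (n - 1) (c_adj l') B {} f (dH_connecting n (c_adj l) X A h)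
      = dH_connecting n (c_adj l') Y B (dH_map n (c_adj l') Y B f h)"
    by (rule dH_connecting_natural[OF f AX BY h])
  show "dH_map n (c_adj l') Y B f h = dH_map n (c_adj l') Y B g h"
    if "pair_map (c_adj l) X A (c_adj l') Y B g" "pair_homotopic (c_adj l) X A (c_adj l') Y B f g" for g
    by (rule dH_map_homotopic[OF f that(1) AX BY c_adj_sym that(2) h])
  show "dH_map n (c_adj l'') Z C (g \<circ> f) h
      = dH_map n (c_adj l'') Z C g (dH_map n (c_adj l') Y B f h)"
    if "digital_pair d'' l'' Z C" "pair_map (c_adj l') Y B (c_adj l'') Z C g" for d'' l'' Z C g
    using dH_map_comp[OF f that(2) AX BY _ h] that(1) by (simp add: digital_pair_def)
next
  fix d l X A W and i :: nat and n :: int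
  assume pair: "digital_pair d l X A" and WA: "W \<subseteq> A" and i: "1 \<le> i"
    and W: "(dig_Cl (c_adj l) X ^^ i) W \<subseteq> (dig_Int (c_adj l) X ^^ i) A" and n: "0 \<le> n" "n \<le> int i + 1"
  have AX: "A \<subseteq> X" using pair by (simp add: digital_pair_def)
  \<comment> \<open>From i \<ge> 1 follows i + 1 \<le> 2i, with equality only for i = 1. The strict
    bound lets the cubes of dimension n + 1 split as well.\<close>
  have "n \<le> 2 * int i" and "\<not> (i = 1 \<and> n = 2) \<Longrightarrow> n < 2 * int i" using i n by auto
  then show "dH_map n (c_adj l) X A id \<in>
        (if i = 1 \<and> n = 2 then epi (dH n (c_adj l) (X - W) (A - W)) (dH n (c_adj l) X A)
         else iso (dH n (c_adj l) (X - W) (A - W)) (dH n (c_adj l) X A))"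
    using dH_excision[OF c_adj_sym AX WA W] by auto
next
  fix n :: int and d l x
  assume "0 < n"
  then show "trivial_group (dH n (c_adj l) {x} {})" by (rule dH_point)
next
  fix n :: int and d l and \<Lambda> :: "'i set" and X
  assume "pairwise (\<lambda>\<alpha> \<beta>. disjnt (X \<alpha>) (X \<beta>) \<and> dig_disconnected (c_adj l) (X \<alpha>) (X \<beta>)) \<Lambda>"
  then show "dH n (c_adj l) (\<Union>\<alpha>\<in>\<Lambda>. X \<alpha>) {} \<cong> sum_group \<Lambda> (\<lambda>\<alpha>. dH n (c_adj l) (X \<alpha>) {})"
    by (intro disconnected_family.dH_additive disconnected_family.intro)
qed

end
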